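(* Let $m_1\ge1$, $\mathcal X=[-1,1]^{m_1}$, $\mathcal Y\subseteq\mathbb{R}$, $\mathcal Z=\mathcal X\times\mathcal Y$, and let $\mathcal D$ be a probability distribution on $\mathcal Z$. Let $d:\mathcal Y\times\mathbb{R}\to[0,1]$ satisfy $|d(y,u)-d(y,u')|\le|u-u'|$ for all $y\in\mathcal Y$, $u,u'\in\mathbb{R}$. Fix $q\in[1,\infty]$, $c,c_o>0$, an integer $k\ge0$, integers $d_1,\dots,d_k\ge1$, $\mathbf d=(m_1,d_1,\dots,d_k,1)$, and $\delta\in(0,1)$. For $f\in\mathcal{N}^{k,\mathbf d}_{1,q,c,c_o}$ let $h_f(x,y)=d(y,f(x))$. Let $S=\{z_1,\dots,z_n\}$ be $n$ i.i.d. samples from $\mathcal D$. Then with probability at least $1-\delta$ over $S$, for all $f\in\mathcal{N}^{k,\mathbf d}_{1,q,c,c_o}$, $$\mathbb{E}_{z\sim\mathcal D}[h_f(z)]\le\frac1n\sum_{i=1}^nh_f(z_i)+\sqrt{\frac{\log(1/\delta)}{2n}}+\frac{2c_o}{\sqrt n}\min\Big(2\max(1,c^k)\sqrt{k+2+\log(m_1+1)},\ \sqrt{(k+1)\log16}\sum_{i=0}^kc^i+c^k\big(\sqrt{2\log(2m_1)}+\sqrt{(k+1)\log16}\big)\Big).$$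
   Context: $\sigma(u)=\max(u,0)$, applied coordinatewise. For a real $s_1\times s_2$ matrix $A=(a_{ij})$: $\|A\|_{p,q}=\big(\sum_{j=1}^{s_2}(\sum_{i=1}^{s_1}|a_{ij}|^p)^{q/p}\big)^{1/q}$ for $q<\infty$, $\|A\|_{p,\infty}=\max_j(\sum_{i}|a_{ij}|^p)^{1/p}$. An affine map $T:\mathbb{R}^{a}\to\mathbb{R}^{b}$, $T(u)=W^Tu+B$, is identified with $\tilde V\in\mathbb{R}^{(a+1)\times b}$ whose first row is $B^T$ and remaining rows form $W$; $\|T\|_{p,q}:=\|\tilde V\|_{p,q}$. For $k\ge0$, width vector $\mathbf d=(d_0,\dots,d_{k+1})$ and $c,c_o>0$, $\mathcal{N}^{k,\mathbf d}_{p,q,c,c_o}$ is the set of all $f=T_{k+1}\circ\sigma\circ T_k\circ\cdots\circ\sigma\circ T_1:\mathbb{R}^{d_0}\to\mathbb{R}^{d_{k+1}}$ with affine $T_i:\mathbb{R}^{d_{i-1}}\to\mathbb{R}^{d_i}$, $\|T_i\|_{p,q}=c$ for $i\le k$ and $\|T_{k+1}\|_{p,q}\le c_o$. *)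

theory Defs
  imports "HOL-Probability.Probability"
begin

text \<open>Vectors in R^a are represented as functions nat => real, only the
coordinates i < a being relevant. An affine map T : R^a -> R^b, T(u) = W^T u + B,
is identified with a matrix V : nat => nat => real with rows 0..a and columns 0..b-1,
row 0 being B^T and rows 1..a forming W.\<close>

definition relu :: "(nat \<Rightarrow> real) \<Rightarrow> (nat \<Rightarrow> real)" where
  "relu u = (\<lambda>j. max (u j) 0)"

definition affine_map :: "(nat \<Rightarrow> nat \<Rightarrow> real) \<Rightarrow> nat \<Rightarrow> (nat \<Rightarrow> real) \<Rightarrow> (nat \<Rightarrow> real)" where
  "affine_map V a u = (\<lambda>j. V 0 j + (\<Sum>i<a. V (Suc i) j * u i))"

definition col_pnorm :: "real \<Rightarrow> (nat \<Rightarrow> nat \<Rightarrow> real) \<Rightarrow> nat \<Rightarrow> nat \<Rightarrow> real" where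
  "col_pnorm p V a j = (\<Sum>i\<le>a. \<bar>V i j\<bar> powr p) powr (1 / p)"

definition mat_norm :: "real \<Rightarrow> ereal \<Rightarrow> (nat \<Rightarrow> nat \<Rightarrow> real) \<Rightarrow> nat \<Rightarrow> nat \<Rightarrow> real" where
  "mat_norm p q V a b =
     (if q = \<infinity> then Max ((\<lambda>j. col_pnorm p V a j) ` {..<b})
      else (\<Sum>j<b. col_pnorm p V a j powr real_of_ereal q) powr (1 / real_of_ereal q))"

fun net_eval :: "(nat \<Rightarrow> nat \<Rightarrow> real) list \<Rightarrow> nat list \<Rightarrow> (nat \<Rightarrow> real) \<Rightarrow> (nat \<Rightarrow> real)" where
  "net_eval [] ds x = x"
| "net_eval [T] ds x = affine_map T (hd ds) x"
| "net_eval (T # T' # Ts) ds x = net_eval (T' # Ts) (tl ds) (relu (affine_map T (hd ds) x))"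

definition NN :: "nat \<Rightarrow> nat list \<Rightarrow> real \<Rightarrow> ereal \<Rightarrow> real \<Rightarrow> real \<Rightarrow> ((nat \<Rightarrow> real) \<Rightarrow> (nat \<Rightarrow> real)) set" where
  "NN k ds p q c co = {f. \<exists>Ts. length Ts = k + 1
       \<and> (\<forall>i<k. mat_norm p q (Ts ! i) (ds ! i) (ds ! Suc i) = c)
       \<and> mat_norm p q (Ts ! k) (ds ! k) (ds ! Suc k) \<le> co
       \<and> f = net_eval Ts ds}"

end

theory Submission
  imports Defs
begin

text \<open>
  McDiarmid's inequality for the supremum of the generalization gap, together with symmetrization by
  a ghost sample, reduces the claim to bounding the empirical Rademacher average of the network class
  on every fixed sample. As \<open>p = 1\<close>, every neuron of a layer lies in \<open>c\<close> times the absolutely convex hull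
  of the constant \<open>1\<close> and the rectified neurons of the layer below, whatever \<open>q \<ge> 1\<close> is. Peeling off
  one layer with the convex function \<open>t \<mapsto> max (t - \<theta>) 0\<close> inside the average produces one bias term
  and a factor 2. A fixed threshold \<open>\<theta>\<close>, chosen only at the end, absorbs the resulting factor
  \<open>2 ^ k\<close> through the sub-Gaussian tail of a single signed sum, and the two choices of \<open>\<theta>\<close> give the
  two terms of the minimum. Only finitely many networks are ever considered at once; the whole class is
  reached through a countable dense set of parameters.
\<close>

section \<open>Sign averages and contraction\<close>

text \<open>The hinge is the right convex function for three reasons. It is nonnegative, so a bias
  splits off a maximum as an additive term. It is convex and increasing, so contraction applies. And
  \<open>t \<le> \<theta> + max (t - \<theta>) 0\<close> makes a factor in front of the hinge
  harmless as soon as the tail beyond \<open>\<theta>\<close> is smaller. The norms of removed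
  layers collect in a scale \<open>s\<close> inside the hinge while \<open>\<theta>\<close> never
  changes, so one threshold has to serve k + 1 biases at the scales \<open>co * c ^ i\<close>.
  Dominating these scales by their maximum yields \<open>max 1 (c ^ k)\<close>, dominating them by
  their sum yields the geometric sum. The dimension \<open>m1\<close> enters only at the bottom,
  where a union bound treats the inputs; hidden widths disappear because a layer passes on nothing
  but a maximum over its neurons. The passage to the whole class meets two obstacles: a supremum
  over uncountably many networks need not be measurable, and the constraint that a norm equals
  \<open>c\<close> may be met by no rational matrix, so rational parameters cannot serve as the
  dense set.\<close>

definition signs :: "nat \<Rightarrow> (nat \<Rightarrow> real) set" where
  "signs n = PiE {..<n} (\<lambda>_. {-1, 1})"

definition sign_avg :: "nat \<Rightarrow> ((nat \<Rightarrow> real) \<Rightarrow> real) \<Rightarrow> real" where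
  "sign_avg n \<Phi> = (\<Sum>\<epsilon>\<in>signs n. \<Phi> \<epsilon>) / 2 ^ n"

definition pairing :: "nat \<Rightarrow> (nat \<Rightarrow> real) \<Rightarrow> (nat \<Rightarrow> real) \<Rightarrow> real" where
  "pairing n \<epsilon> a = (\<Sum>i<n. \<epsilon> i * a i)"

lemma finite_signs [simp]: "finite (signs n)"
  unfolding signs_def by (intro finite_PiE) auto

lemma card_signs: "card (signs n) = 2 ^ n"
  unfolding signs_def by (subst card_PiE) (auto simp: numeral_2_eq_2)

lemma signs_cases: "\<epsilon> \<in> signs n \<Longrightarrow> i < n \<Longrightarrow> \<epsilon> i = -1 \<or> \<epsilon> i = 1"
  unfolding signs_def by (auto simp: PiE_def Pi_def)

lemma abs_signs: "\<epsilon> \<in> signs n \<Longrightarrow> i < n \<Longrightarrow> \<bar>\<epsilon> i\<bar> = 1"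
  using signs_cases by fastforce

lemma sign_avg_mono:
  assumes "\<And>\<epsilon>. \<epsilon> \<in> signs n \<Longrightarrow> \<Phi> \<epsilon> \<le> \<Psi> \<epsilon>"
  shows "sign_avg n \<Phi> \<le> sign_avg n \<Psi>"
  unfolding sign_avg_def by (intro divide_right_mono sum_mono assms) auto

lemma sign_avg_cong:
  assumes "\<And>\<epsilon>. \<epsilon> \<in> signs n \<Longrightarrow> \<Phi> \<epsilon> = \<Psi> \<epsilon>"
  shows "sign_avg n \<Phi> = sign_avg n \<Psi>"
  unfolding sign_avg_def using assms by (simp cong: sum.cong)

lemma sign_avg_add: "sign_avg n (\<lambda>\<epsilon>. \<Phi> \<epsilon> + \<Psi> \<epsilon>) = sign_avg n \<Phi> + sign_avg n \<Psi>"
  unfolding sign_avg_def by (simp add: sum.distrib add_divide_distrib)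

lemma sign_avg_cmult: "sign_avg n (\<lambda>\<epsilon>. a * \<Phi> \<epsilon>) = a * sign_avg n \<Phi>"
  unfolding sign_avg_def by (simp add: sum_distrib_left)

lemma sign_avg_const: "sign_avg n (\<lambda>_. a) = a"
  unfolding sign_avg_def by (simp add: card_signs)

lemma sign_avg_flip:
  assumes "i < n"
  shows "sign_avg n (\<lambda>\<epsilon>. \<Phi> (\<epsilon>(i := - \<epsilon> i))) = sign_avg n \<Phi>"
proof -
  have mem: "\<epsilon>(i := - \<epsilon> i) \<in> signs n" if "\<epsilon> \<in> signs n" for \<epsilon>
    unfolding signs_def
  proof (rule PiE_I)
    fix j assume "j \<in> {..<n}"
    then show "(\<epsilon>(i := - \<epsilon> i)) j \<in> {- 1, 1}"
      using signs_cases[OF that, of j] by auto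
  qed (use that assms in \<open>auto simp: signs_def PiE_def extensional_def\<close>)
  have "(\<Sum>\<epsilon>\<in>signs n. \<Phi> (\<epsilon>(i := - \<epsilon> i))) = (\<Sum>\<epsilon>\<in>signs n. \<Phi> \<epsilon>)"
    by (rule sum.reindex_bij_witness[where i = "\<lambda>\<epsilon>. \<epsilon>(i := - \<epsilon> i)" and j = "\<lambda>\<epsilon>. \<epsilon>(i := - \<epsilon> i)"])
      (auto intro: mem)
  then show ?thesis
    unfolding sign_avg_def by simp
qed

text \<open>\<open>\<Phi>\<close> receives the whole functional \<open>pairing n \<epsilon>\<close>,
  so that one global sign reversal also covers expressions evaluating it at many vectors, such as a
  maximum. Reversed signs are restricted to \<open>{..<n}\<close> to stay extensional.\<close>

lemma sign_avg_pairing_uminus: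
  "sign_avg n (\<lambda>\<epsilon>. \<Phi> (\<lambda>a. - pairing n \<epsilon> a)) = sign_avg n (\<lambda>\<epsilon>. \<Phi> (pairing n \<epsilon>))"
proof -
  define neg where "neg = (\<lambda>\<epsilon>::nat \<Rightarrow> real. \<lambda>i\<in>{..<n}. - \<epsilon> i)"
  have mem: "neg \<epsilon> \<in> signs n" if "\<epsilon> \<in> signs n" for \<epsilon>
    unfolding signs_def
  proof (rule PiE_I)
    fix j assume "j \<in> {..<n}"
    then show "neg \<epsilon> j \<in> {- 1, 1}"
      using signs_cases[OF that, of j] by (auto simp: neg_def)
  qed (simp add: neg_def)
  have inv: "neg (neg \<epsilon>) = \<epsilon>" if "\<epsilon> \<in> signs n" for \<epsilon>
    using that unfolding signs_def neg_def by (auto simp: PiE_def extensional_def)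
  have pair: "pairing n (neg \<epsilon>) = (\<lambda>a. - pairing n \<epsilon> a)" for \<epsilon>
    by (auto simp: pairing_def neg_def sum_negf)
  have "(\<Sum>\<epsilon>\<in>signs n. \<Phi> (\<lambda>a. - pairing n \<epsilon> a)) = (\<Sum>\<epsilon>\<in>signs n. \<Phi> (pairing n \<epsilon>))"
    by (rule sum.reindex_bij_witness[where i = neg and j = neg]) (auto simp: mem inv pair)
  then show ?thesis
    unfolding sign_avg_def by simp
qed

section \<open>Contraction under a convex increasing function\<close>

text \<open>The two-point case of weak majorization (Karamata, Tomic-Weyl): the hypotheses say that
  the pair (a, b) is weakly majorized by (P, Q).\<close>

lemma convex_mono_weak_majorization:
  fixes G :: "real \<Rightarrow> real"
  assumes cv: "convex_on UNIV G" and mono: "mono G"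
    and sum: "a + b \<le> P + Q" and a: "a \<le> max P Q" and b: "b \<le> max P Q"
  shows "G a + G b \<le> G P + G Q"
proof -
  have main: "G x + G y \<le> G p + G r"
    if "y \<le> x" "x \<le> p" "r \<le> p" "x + y \<le> p + r" for x y p r
  proof (cases "y \<le> r")
    case True
    then show ?thesis
      using that monoD[OF mono, of x p] monoD[OF mono, of y r] by linarith
  next
    case False
    then have rp: "r < p" using that by linarith
    \<comment> \<open>\<open>y\<close> is the convex combination of \<open>p\<close> and
      \<open>r\<close> with weight \<open>t\<close>, and \<open>x\<close> lies below its mirror
      image \<open>p + r - y\<close>, where the weights are exchanged. Adding the two convexity
      bounds cancels \<open>t\<close>.\<close>
    define t where "t = (p - y) / (p - r)"
    have t: "0 \<le> t" "t \<le> 1"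
      using False that rp by (auto simp: t_def field_simps)
    have "t * (p - r) = p - y"
      using rp by (simp add: t_def)
    then have y: "y = (1 - t) * p + t * r"
      by (simp add: algebra_simps)
    have "x \<le> (1 - t) * r + t * p"
      using that(4) unfolding y by (simp add: algebra_simps)
    then have "G x \<le> G ((1 - t) * r + t * p)"
      by (rule monoD[OF mono])
    also have "\<dots> \<le> (1 - t) * G r + t * G p"
      using convex_onD[OF cv t, of r p] by simp
    finally have "G x \<le> (1 - t) * G r + t * G p" .
    moreover have "G y \<le> (1 - t) * G p + t * G r"
      using convex_onD[OF cv t, of p r] unfolding y by simp
    ultimately show ?thesis by (simp add: algebra_simps)
  qed
  show ?thesis
    using main[of b a P Q] main[of a b P Q] main[of b a Q P] main[of a b Q P] sum a b
    by (cases "Q \<le> P"; cases "b \<le> a") (auto simp: max_def split: if_splits)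
qed

lemma contraction_one_coordinate:
  fixes G :: "real \<Rightarrow> real" and r x a :: "'f \<Rightarrow> real"
  assumes F: "finite F" "F \<noteq> {}"
    and G: "convex_on UNIV G" "mono G"
    and lip: "\<And>f g. f \<in> F \<Longrightarrow> g \<in> F \<Longrightarrow> \<bar>a f - a g\<bar> \<le> \<bar>x f - x g\<bar>"
    and abs: "\<And>f. f \<in> F \<Longrightarrow> \<bar>a f\<bar> \<le> \<bar>x f\<bar>"
  shows "(MAX f\<in>F. G (r f + a f)) + (MAX f\<in>F. G (r f - a f))
    \<le> (MAX f\<in>F. G (r f + x f)) + (MAX f\<in>F. G (r f - x f))"
proof -
  have "(MAX f\<in>F. G (r f + a f)) \<in> (\<lambda>f. G (r f + a f)) ` F"
    "(MAX f\<in>F. G (r f - a f)) \<in> (\<lambda>f. G (r f - a f)) ` F"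
    using F by (intro Max_in; auto)+
  then obtain f g where f: "f \<in> F" "(MAX f\<in>F. G (r f + a f)) = G (r f + a f)"
    and g: "g \<in> F" "(MAX f\<in>F. G (r f - a f)) = G (r g - a g)"
    by auto
  \<comment> \<open>\<open>P\<close> and \<open>Q\<close> are each attained at \<open>f\<close> or
    at \<open>g\<close>, hence lie below the maxima on the right. Comparing \<open>f\<close> with
    \<open>g\<close> through \<open>lip\<close> controls the sum of the two arguments;
    \<open>abs\<close> controls each argument separately, as majorization requires.\<close>
  define P where "P = max (r f + x f) (r g + x g)"
  define Q where "Q = max (r f - x f) (r g - x g)"
  have "G (r f + a f) + G (r g - a g) \<le> G P + G Q"
    using lip[OF f(1) g(1)] abs[OF f(1)] abs[OF g(1)]
    by (intro convex_mono_weak_majorization[OF G]) (auto simp: P_def Q_def)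
  also have "G P \<le> (MAX f\<in>F. G (r f + x f))"
    using F f g by (auto simp: P_def max_def intro!: Max_ge)
  also have "G Q \<le> (MAX f\<in>F. G (r f - x f))"
    using F f g by (auto simp: Q_def max_def intro!: Max_ge)
  finally show ?thesis
    using f g by simp
qed

text \<open>The coordinates are contracted one after the other; averaging over the sign of the current
  coordinate reduces each step to the case of one coordinate.\<close>
lemma contraction_principle:
  fixes G :: "real \<Rightarrow> real" and t :: "'f \<Rightarrow> nat \<Rightarrow> real" and \<phi> :: "nat \<Rightarrow> real \<Rightarrow> real"
  assumes F: "finite F" "F \<noteq> {}"
    and G: "convex_on UNIV G" "mono G"
    and lip: "\<And>i u v. i < n \<Longrightarrow> \<bar>\<phi> i u - \<phi> i v\<bar> \<le> \<bar>u - v\<bar>"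
    and zero: "\<And>i. i < n \<Longrightarrow> \<phi> i 0 = 0"
  shows "sign_avg n (\<lambda>\<epsilon>. MAX f\<in>F. G (pairing n \<epsilon> (\<lambda>i. \<phi> i (t f i))))
    \<le> sign_avg n (\<lambda>\<epsilon>. MAX f\<in>F. G (pairing n \<epsilon> (t f)))"
proof -
  \<comment> \<open>Hybrids with \<open>\<phi>\<close> applied to the first \<open>m\<close>
    coordinates only; \<open>R n\<close> and \<open>R 0\<close> are the two sides of the
    claim.\<close>
  define s where "s = (\<lambda>m f i. if i < m then \<phi> i (t f i) else t f i)"
  define R where "R = (\<lambda>m. sign_avg n (\<lambda>\<epsilon>. MAX f\<in>F. G (pairing n \<epsilon> (s m f))))"
  have step: "R (Suc m) \<le> R m" if m: "m < n" for m
  proof -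
    define \<Phi> where "\<Phi> = (\<lambda>l \<epsilon>. MAX f\<in>F. G (pairing n \<epsilon> (s l f)))"
    have sym: "2 * R l = sign_avg n (\<lambda>\<epsilon>. \<Phi> l \<epsilon> + \<Phi> l (\<epsilon>(m := - \<epsilon> m)))" for l
      unfolding sign_avg_add sign_avg_flip[OF m] by (simp add: R_def \<Phi>_def)
    have "2 * R (Suc m) \<le> 2 * R m"
      unfolding sym
    proof (rule sign_avg_mono)
      fix \<epsilon> assume \<epsilon>: "\<epsilon> \<in> signs n"
      define r where "r = (\<lambda>f. \<Sum>i\<in>{..<n} - {m}. \<epsilon> i * s m f i)"
      define a where "a = (\<lambda>f. \<epsilon> m * \<phi> m (t f m))"
      define x where "x = (\<lambda>f. \<epsilon> m * t f m)"
      have split: "pairing n e v = (\<Sum>i\<in>{..<n} - {m}. e i * v i) + e m * v m" for e v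
        using m by (simp add: pairing_def sum.remove[of _ m])
      have rest: "(\<Sum>i\<in>{..<n} - {m}. \<epsilon> i * s (Suc m) f i) = r f" for f
        unfolding r_def by (intro sum.cong) (auto simp: s_def)
      have upd: "(\<Sum>i\<in>{..<n} - {m}. (\<epsilon>(m := - \<epsilon> m)) i * v i) = (\<Sum>i\<in>{..<n} - {m}. \<epsilon> i * v i)" for v
        by (intro sum.cong) auto
      have p: "pairing n \<epsilon> (s (Suc m) f) = r f + a f" "pairing n \<epsilon> (s m f) = r f + x f"
        "pairing n (\<epsilon>(m := - \<epsilon> m)) (s (Suc m) f) = r f - a f"
        "pairing n (\<epsilon>(m := - \<epsilon> m)) (s m f) = r f - x f" for f
        unfolding split upd rest by (auto simp: r_def a_def x_def s_def)
      show "\<Phi> (Suc m) \<epsilon> + \<Phi> (Suc m) (\<epsilon>(m := - \<epsilon> m)) \<le> \<Phi> m \<epsilon> + \<Phi> m (\<epsilon>(m := - \<epsilon> m))"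
        unfolding \<Phi>_def p
      proof (rule contraction_one_coordinate[OF F G])
        show "\<bar>a f - a g\<bar> \<le> \<bar>x f - x g\<bar>" for f g
          using lip[OF m, of "t f m" "t g m"] abs_signs[OF \<epsilon> m]
          by (simp add: a_def x_def abs_mult flip: right_diff_distrib)
        show "\<bar>a f\<bar> \<le> \<bar>x f\<bar>" for f
          using lip[OF m, of "t f m" 0] zero[OF m] abs_signs[OF \<epsilon> m]
          by (simp add: a_def x_def abs_mult)
      qed
    qed
    then show ?thesis by simp
  qed
  have "R m \<le> R 0" if "m \<le> n" for m
    using that
  proof (induction m)
    case (Suc m)
    then show ?case using step[of m] by simp
  qed simp
  from this[of n] have "R n \<le> R 0" by simp
  moreover have "R n = sign_avg n (\<lambda>\<epsilon>. MAX f\<in>F. G (pairing n \<epsilon> (\<lambda>i. \<phi> i (t f i))))"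
  proof -
    have "pairing n \<epsilon> (s n f) = pairing n \<epsilon> (\<lambda>i. \<phi> i (t f i))" for \<epsilon> f
      unfolding pairing_def by (intro sum.cong) (auto simp: s_def)
    then show ?thesis by (simp add: R_def)
  qed
  moreover have "R 0 = sign_avg n (\<lambda>\<epsilon>. MAX f\<in>F. G (pairing n \<epsilon> (t f)))"
    by (simp add: R_def s_def)
  ultimately show ?thesis by simp
qed

section \<open>Sub-Gaussian tail of a single signed sum\<close>

lemma cosh_le_exp_half_square:
  fixes x :: real
  shows "(exp x + exp (- x)) / 2 \<le> exp (x\<^sup>2 / 2)"
proof -
  have nonneg: "(exp y + exp (- y)) / 2 \<le> exp (y\<^sup>2 / 2)" if "y \<ge> 0" for y :: real
  proof -
    have pos: "1 + 1 / 2 * (exp (2 * y) - 1) > 0"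
      using exp_gt_zero[of "2 * y"] by (simp add: field_simps add_pos_pos)
    \<comment> \<open>A fair sign times \<open>y\<close> is a shifted Bernoulli variable with
      parameter 1/2 and range \<open>2 * y\<close>; Hoeffding's bound then gives
      \<open>(2 * y)\<^sup>2 / 8\<close>.\<close>
    have "(exp y + exp (- y)) / 2 = exp (- y) * (1 + 1 / 2 * (exp (2 * y) - 1))"
      by (simp add: field_simps flip: exp_add)
    also have "\<dots> = exp (- (2 * y) * (1 / 2) + ln (1 + 1 / 2 * (exp (2 * y) - 1)))"
      unfolding exp_add exp_ln[OF pos] by simp
    also have "\<dots> \<le> exp ((2 * y)\<^sup>2 / 8)"
      using Hoeffdings_lemma_aux[of "2 * y" "1 / 2"] that by simp
    finally show ?thesis by simp
  qed
  show ?thesis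
    using nonneg[of x] nonneg[of "- x"] by (cases "x \<ge> 0") (auto simp: add.commute)
qed

lemma sign_avg_exp_le:
  assumes a: "\<And>i. i < n \<Longrightarrow> \<bar>a i\<bar> \<le> 1"
  shows "sign_avg n (\<lambda>\<epsilon>. exp (l * pairing n \<epsilon> a)) \<le> exp (l\<^sup>2 * n / 2)"
proof -
  have "(\<Sum>\<epsilon>\<in>signs n. exp (l * pairing n \<epsilon> a)) = (\<Sum>\<epsilon>\<in>signs n. \<Prod>i<n. exp (l * (\<epsilon> i * a i)))"
    by (simp add: pairing_def sum_distrib_left exp_sum)
  also have "\<dots> = (\<Prod>i<n. \<Sum>e\<in>{-1, 1}. exp (l * (e * a i)))"
    unfolding signs_def by (subst prod_sum_PiE) auto
  also have "\<dots> = (\<Prod>i<n. exp (l * a i) + exp (- (l * a i)))"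
    by (simp add: add.commute)
  finally have "sign_avg n (\<lambda>\<epsilon>. exp (l * pairing n \<epsilon> a))
      = (\<Prod>i<n. (exp (l * a i) + exp (- (l * a i))) / 2)"
    by (simp add: sign_avg_def prod_dividef)
  also have "\<dots> \<le> (\<Prod>i<n. exp (l\<^sup>2 / 2))"
  proof (intro prod_mono conjI)
    fix i assume "i \<in> {..<n}"
    then have "(l * a i)\<^sup>2 \<le> l\<^sup>2"
      using a[of i] by (simp add: power_mult_distrib mult_left_le abs_square_le_1)
    then show "(exp (l * a i) + exp (- (l * a i))) / 2 \<le> exp (l\<^sup>2 / 2)"
      using cosh_le_exp_half_square[of "l * a i"] by (meson divide_right_mono exp_le_cancel_iff order_trans zero_le_numeral)
  qed (auto simp: add_nonneg_nonneg)
  also have "\<dots> = exp (l\<^sup>2 * n / 2)"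
    by (simp flip: exp_of_nat_mult)
  finally show ?thesis .
qed

text \<open>The Chernoff bound for the mean of
  \<open>max (s * \<bar>pairing n \<epsilon> a\<bar> - \<theta>) 0\<close> with
  \<open>\<bar>a i\<bar> \<le> 1\<close>. The exponential is the Gaussian tail at variance
  \<open>s\<^sup>2 * n\<close>, the factor 2 accounts for the two signs of the sum, and
  \<open>exp 1\<close> comes from replacing the hinge by an exponential.\<close>

definition excess :: "real \<Rightarrow> nat \<Rightarrow> real \<Rightarrow> real" where
  "excess \<theta> n s = 2 * (s\<^sup>2 * n) / (exp 1 * \<theta>) * exp (- \<theta>\<^sup>2 / (2 * (s\<^sup>2 * n)))"

text \<open>The tangent inequality \<open>x \<le> exp (x - 1)\<close> at \<open>x = l * u\<close>,
  sharp for \<open>l * u = 1\<close>.\<close>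

lemma hinge_le_exp:
  fixes u l :: real
  assumes "l > 0"
  shows "max u 0 \<le> exp (l * u) / (exp 1 * l)"
proof -
  have "l * u \<le> exp (l * u - 1)"
    using exp_ge_add_one_self[of "l * u - 1"] by simp
  then show ?thesis
    using assms by (auto simp: exp_diff field_simps)
qed

lemma sign_avg_hinge_le:
  assumes a: "\<And>i. i < n \<Longrightarrow> \<bar>a i\<bar> \<le> 1" and n: "n > 0" and s: "s > 0" and \<theta>: "\<theta> > 0"
  shows "sign_avg n (\<lambda>\<epsilon>. max (s * \<bar>pairing n \<epsilon> a\<bar> - \<theta>) 0) \<le> excess \<theta> n s"
proof -
  \<comment> \<open>This value minimizes the exponent
    \<open>l\<^sup>2 * s\<^sup>2 * n / 2 - l * \<theta>\<close>; the minimum is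
    \<open>- \<theta>\<^sup>2 / (2 * (s\<^sup>2 * n))\<close>.\<close>
  define l where "l = \<theta> / (s\<^sup>2 * n)"
  have sn: "s\<^sup>2 * n > 0" using n s by simp
  have l: "l > 0" using sn \<theta> by (simp add: l_def)
  define K where "K = exp (- (l * \<theta>)) / (exp 1 * l)"
  have K: "K \<ge> 0" using l by (simp add: K_def)
  have pt: "max (s * \<bar>pairing n \<epsilon> a\<bar> - \<theta>) 0
      \<le> K * (exp ((l * s) * pairing n \<epsilon> a) + exp ((- (l * s)) * pairing n \<epsilon> a))" for \<epsilon>
  proof -
    let ?p = "pairing n \<epsilon> a"
    have "max (s * \<bar>?p\<bar> - \<theta>) 0 \<le> exp (l * (s * \<bar>?p\<bar> - \<theta>)) / (exp 1 * l)"
      by (rule hinge_le_exp[OF l])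
    also have "\<dots> = K * exp (l * s * \<bar>?p\<bar>)"
      by (simp add: K_def right_diff_distrib exp_diff exp_minus field_simps)
    also have "\<dots> \<le> K * (exp ((l * s) * ?p) + exp ((- (l * s)) * ?p))"
      using K by (intro mult_left_mono) (auto simp: abs_if)
    finally show ?thesis .
  qed
  have "sign_avg n (\<lambda>\<epsilon>. max (s * \<bar>pairing n \<epsilon> a\<bar> - \<theta>) 0)
      \<le> sign_avg n (\<lambda>\<epsilon>. K * (exp ((l * s) * pairing n \<epsilon> a) + exp ((- (l * s)) * pairing n \<epsilon> a)))"
    by (intro sign_avg_mono pt)
  also have "\<dots> \<le> K * (exp ((l * s)\<^sup>2 * n / 2) + exp ((- (l * s))\<^sup>2 * n / 2))"
    unfolding sign_avg_cmult sign_avg_add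
    by (intro mult_left_mono add_mono sign_avg_exp_le a K)
  also have "\<dots> = 2 / (exp 1 * l) * exp ((l * s)\<^sup>2 * n / 2 - l * \<theta>)"
  proof -
    have "exp ((l * s)\<^sup>2 * n / 2 - l * \<theta>) = exp ((l * s)\<^sup>2 * n / 2) * exp (- (l * \<theta>))"
      using exp_add[of "(l * s)\<^sup>2 * n / 2" "- (l * \<theta>)"] by simp
    moreover have "b / d * (a + a) = 2 / d * (a * b)" for a b d :: real
      by (simp add: divide_inverse algebra_simps)
    ultimately show ?thesis
      unfolding K_def power2_minus by (simp only:)
  qed
  also have "(l * s)\<^sup>2 * n / 2 - l * \<theta> = - \<theta>\<^sup>2 / (2 * (s\<^sup>2 * n))"
    using sn n s by (simp add: l_def field_simps power2_eq_square)
  also have "2 / (exp 1 * l) * exp (- \<theta>\<^sup>2 / (2 * (s\<^sup>2 * n))) = excess \<theta> n s"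
    using sn \<theta> by (simp add: excess_def l_def field_simps)
  finally show ?thesis .
qed

section \<open>Peeling off the layers of a network\<close>

lemma convex_hinge: "convex_on UNIV (\<lambda>x::real. max (s * x - \<theta>) 0)"
proof (rule convex_onI)
  fix t x y :: real assume t: "0 < t" "t < 1"
  have "(1 - t) * (s * x - \<theta>) \<le> (1 - t) * max (s * x - \<theta>) 0"
    "t * (s * y - \<theta>) \<le> t * max (s * y - \<theta>) 0"
    "0 \<le> (1 - t) * max (s * x - \<theta>) 0" "0 \<le> t * max (s * y - \<theta>) 0"
    using t by (auto intro!: mult_left_mono mult_nonneg_nonneg)
  moreover have "s * ((1 - t) * x + t * y) - \<theta> = (1 - t) * (s * x - \<theta>) + t * (s * y - \<theta>)"
    by (simp add: algebra_simps)
  ultimately show "max (s * ((1 - t) *\<^sub>R x + t *\<^sub>R y) - \<theta>) 0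
      \<le> (1 - t) * max (s * x - \<theta>) 0 + t * max (s * y - \<theta>) 0"
    by simp
qed simp

lemma mono_hinge: "s \<ge> 0 \<Longrightarrow> mono (\<lambda>x::real. max (s * x - \<theta>) 0)"
  by (intro monoI max.mono diff_mono mult_left_mono) auto

section \<open>Averages of thresholded maxima\<close>

text \<open>The elements of \<open>V\<close> are vectors of values on the sample. The scale stays
  inside the hinge as a separate argument, so that a layer norm can be moved into it without
  touching \<open>\<theta>\<close>.\<close>

definition hinge_avg :: "real \<Rightarrow> nat \<Rightarrow> real \<Rightarrow> (nat \<Rightarrow> real) set \<Rightarrow> real" where
  "hinge_avg \<theta> n s V = sign_avg n (\<lambda>\<epsilon>. MAX v\<in>V. max (s * \<bar>pairing n \<epsilon> v\<bar> - \<theta>) 0)"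

text \<open>Dropping the absolute value before the contraction costs the factor 2; it only enters
  additively in the end because the threshold \<open>\<theta>\<close> is chosen after all layers are peeled off.\<close>
lemma hinge_avg_relu_le:
  assumes U: "finite U" "U \<noteq> {}" and s: "s \<ge> 0"
  shows "hinge_avg \<theta> n s (relu ` U) \<le> 2 * hinge_avg \<theta> n s U"
proof -
  define H where "H = (\<lambda>x::real. max (s * x - \<theta>) 0)"
  have H: "convex_on UNIV H" "mono H"
    unfolding H_def by (fact convex_hinge, intro mono_hinge s)
  have H0: "H x \<ge> 0" for x by (simp add: H_def)
  have "hinge_avg \<theta> n s (relu ` U) = sign_avg n (\<lambda>\<epsilon>. MAX u\<in>U. H \<bar>pairing n \<epsilon> (relu u)\<bar>)"
    by (simp add: hinge_avg_def H_def image_image)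
  \<comment> \<open>\<open>H\<close> after an absolute value is not increasing, so contraction
    cannot be applied to it directly. As \<open>H\<close> is nonnegative,
    \<open>H \<bar>t\<bar> \<le> H t + H (- t)\<close>, and both summands have the same sign
    average.\<close>
  also have "\<dots> \<le> sign_avg n (\<lambda>\<epsilon>. (MAX u\<in>U. H (pairing n \<epsilon> (relu u)))
      + (MAX u\<in>U. H (- pairing n \<epsilon> (relu u))))"
  proof (rule sign_avg_mono)
    fix \<epsilon>
    have "H \<bar>pairing n \<epsilon> (relu u)\<bar> \<le> (MAX u\<in>U. H (pairing n \<epsilon> (relu u)))
        + (MAX u\<in>U. H (- pairing n \<epsilon> (relu u)))" if u: "u \<in> U" for u
    proof -
      have "H (pairing n \<epsilon> (relu u)) \<le> (MAX u\<in>U. H (pairing n \<epsilon> (relu u)))"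
        "H (- pairing n \<epsilon> (relu u)) \<le> (MAX u\<in>U. H (- pairing n \<epsilon> (relu u)))"
        using U u by (auto intro!: Max_ge)
      then show ?thesis
        using H0[of "pairing n \<epsilon> (relu u)"] H0[of "- pairing n \<epsilon> (relu u)"]
        by (auto simp: abs_if)
    qed
    then show "(MAX u\<in>U. H \<bar>pairing n \<epsilon> (relu u)\<bar>) \<le> (MAX u\<in>U. H (pairing n \<epsilon> (relu u)))
        + (MAX u\<in>U. H (- pairing n \<epsilon> (relu u)))"
      using U by (intro Max.boundedI) auto
  qed
  also have "\<dots> = 2 * sign_avg n (\<lambda>\<epsilon>. MAX u\<in>U. H (pairing n \<epsilon> (relu u)))"
    unfolding sign_avg_add
    using sign_avg_pairing_uminus[of n "\<lambda>p. MAX u\<in>U. H (p (relu u))"] by simp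
  also have "\<dots> \<le> 2 * sign_avg n (\<lambda>\<epsilon>. MAX u\<in>U. H (pairing n \<epsilon> u))"
    using contraction_principle[OF U H, where \<phi> = "\<lambda>_ z. max z 0" and t = "\<lambda>u. u" and n = n]
    by (simp add: relu_def)
  also have "\<dots> \<le> 2 * sign_avg n (\<lambda>\<epsilon>. MAX u\<in>U. H \<bar>pairing n \<epsilon> u\<bar>)"
  proof (intro mult_left_mono sign_avg_mono)
    fix \<epsilon>
    show "(MAX u\<in>U. H (pairing n \<epsilon> u)) \<le> (MAX u\<in>U. H \<bar>pairing n \<epsilon> u\<bar>)"
    proof (intro Max.boundedI)
      fix y assume "y \<in> (\<lambda>u. H (pairing n \<epsilon> u)) ` U"
      then obtain u where u: "u \<in> U" "y = H (pairing n \<epsilon> u)" by auto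
      have "y \<le> H \<bar>pairing n \<epsilon> u\<bar>"
        unfolding u by (rule monoD[OF H(2) abs_ge_self])
      also have "\<dots> \<le> (MAX u\<in>U. H \<bar>pairing n \<epsilon> u\<bar>)"
        using U u by (intro Max_ge) auto
      finally show "y \<le> (MAX u\<in>U. H \<bar>pairing n \<epsilon> u\<bar>)" .
    qed (use U in auto)
  qed simp
  finally show ?thesis
    by (simp add: hinge_avg_def H_def)
qed

text \<open>\<open>dom\<close> is the dual form of saying that \<open>v\<close> lies in
  \<open>\<gamma>\<close> times the absolutely convex hull of \<open>U\<close> and the constant 1: a
  linear functional bounded by \<open>B\<close> on the generators is bounded by
  \<open>\<gamma> * B\<close> on the hull. In this form no hull has to be constructed.\<close>

lemma hinge_avg_hull_le:
  assumes V: "finite V" "V \<noteq> {}" and U: "finite U" and s: "s \<ge> 0" and \<gamma>: "\<gamma> \<ge> 0"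
    and dom: "\<And>\<epsilon> v B. v \<in> V \<Longrightarrow> \<bar>pairing n \<epsilon> (\<lambda>_. 1)\<bar> \<le> B
      \<Longrightarrow> (\<And>u. u \<in> U \<Longrightarrow> \<bar>pairing n \<epsilon> u\<bar> \<le> B) \<Longrightarrow> \<bar>pairing n \<epsilon> v\<bar> \<le> \<gamma> * B"
  shows "hinge_avg \<theta> n s V \<le> hinge_avg \<theta> n (s * \<gamma>) (insert (\<lambda>_. 1) U)"
  unfolding hinge_avg_def
proof (rule sign_avg_mono)
  fix \<epsilon>
  let ?U = "insert (\<lambda>_. 1) U"
  have "(MAX u\<in>?U. \<bar>pairing n \<epsilon> u\<bar>) \<in> (\<lambda>u. \<bar>pairing n \<epsilon> u\<bar>) ` ?U"
    using U by (intro Max_in) auto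
  then obtain w where w: "w \<in> ?U" "(MAX u\<in>?U. \<bar>pairing n \<epsilon> u\<bar>) = \<bar>pairing n \<epsilon> w\<bar>"
    by blast
  have wmax: "\<bar>pairing n \<epsilon> u\<bar> \<le> \<bar>pairing n \<epsilon> w\<bar>" if "u \<in> ?U" for u
    unfolding w(2)[symmetric] using that U by (intro Max_ge) auto
  have "max (s * \<bar>pairing n \<epsilon> v\<bar> - \<theta>) 0 \<le> max (s * \<gamma> * \<bar>pairing n \<epsilon> w\<bar> - \<theta>) 0" if "v \<in> V" for v
  proof -
    have "\<bar>pairing n \<epsilon> v\<bar> \<le> \<gamma> * \<bar>pairing n \<epsilon> w\<bar>"
      using that wmax by (intro dom) auto
    then have "s * \<bar>pairing n \<epsilon> v\<bar> \<le> s * (\<gamma> * \<bar>pairing n \<epsilon> w\<bar>)"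
      using s by (rule mult_left_mono)
    then show ?thesis by (simp add: mult.assoc max_def)
  qed
  moreover have "max (s * \<gamma> * \<bar>pairing n \<epsilon> w\<bar> - \<theta>) 0
      \<le> (MAX u\<in>?U. max (s * \<gamma> * \<bar>pairing n \<epsilon> u\<bar> - \<theta>) 0)"
    using w(1) U by (intro Max_ge imageI finite_imageI) auto
  ultimately have "max (s * \<bar>pairing n \<epsilon> v\<bar> - \<theta>) 0
      \<le> (MAX u\<in>?U. max (s * \<gamma> * \<bar>pairing n \<epsilon> u\<bar> - \<theta>) 0)" if "v \<in> V" for v
    using that order_trans by blast
  then show "(MAX v\<in>V. max (s * \<bar>pairing n \<epsilon> v\<bar> - \<theta>) 0)
      \<le> (MAX u\<in>?U. max (s * \<gamma> * \<bar>pairing n \<epsilon> u\<bar> - \<theta>) 0)"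
    using V by (intro Max.boundedI) auto
qed

text \<open>A maximum of nonnegative numbers is at most their sum. This separates the bias, so that
  it costs one additive tail instead of being carried down through the remaining layers.\<close>

lemma hinge_avg_insert_le:
  assumes "finite U" "U \<noteq> {}"
  shows "hinge_avg \<theta> n s (insert v U) \<le> hinge_avg \<theta> n s {v} + hinge_avg \<theta> n s U"
  unfolding hinge_avg_def sign_avg_add[symmetric]
proof (rule sign_avg_mono)
  fix \<epsilon>
  define h where "h = (\<lambda>u. max (s * \<bar>pairing n \<epsilon> u\<bar> - \<theta>) 0)"
  have h: "h u \<ge> 0" for u by (simp add: h_def)
  then have "0 \<le> (MAX u\<in>U. h u)"
    using assms by (auto simp: Max_ge_iff)
  then have "(MAX u\<in>insert v U. h u) \<le> (MAX u\<in>{v}. h u) + (MAX u\<in>U. h u)"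
    using assms h[of v] by (simp add: max_def)
  then show "(MAX u\<in>insert v U. max (s * \<bar>pairing n \<epsilon> u\<bar> - \<theta>) 0)
      \<le> (MAX u\<in>{v}. max (s * \<bar>pairing n \<epsilon> u\<bar> - \<theta>) 0)
        + (MAX u\<in>U. max (s * \<bar>pairing n \<epsilon> u\<bar> - \<theta>) 0)"
    by (simp add: h_def)
qed

lemma hinge_avg_singleton_le:
  assumes "\<And>i. i < n \<Longrightarrow> \<bar>v i\<bar> \<le> 1" "n > 0" "s > 0" "\<theta> > 0"
  shows "hinge_avg \<theta> n s {v} \<le> excess \<theta> n s"
  using sign_avg_hinge_le[of n v s \<theta>] assms by (simp add: hinge_avg_def)

lemma hinge_avg_finite_le:
  assumes "finite U" "U \<noteq> {}"
    and u: "\<And>u i. u \<in> U \<Longrightarrow> i < n \<Longrightarrow> \<bar>u i\<bar> \<le> 1" and "n > 0" "s > 0" "\<theta> > 0"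
  shows "hinge_avg \<theta> n s U \<le> card U * excess \<theta> n s"
  using assms(1,2) u
proof (induction rule: finite_ne_induct)
  case (singleton v)
  then show ?case
    using hinge_avg_singleton_le[of n v] assms by simp
next
  case (insert v U)
  have "hinge_avg \<theta> n s (insert v U) \<le> hinge_avg \<theta> n s {v} + hinge_avg \<theta> n s U"
    using insert by (intro hinge_avg_insert_le) auto
  also have "\<dots> \<le> excess \<theta> n s + card U * excess \<theta> n s"
    using insert assms by (intro add_mono hinge_avg_singleton_le) auto
  finally show ?case
    using insert by (simp add: algebra_simps)
qed

section \<open>Networks seen from the output layer\<close>

text \<open>\<open>net_eval\<close> consumes the layers from the input side, whereas peeling removes
  the last layer first. This recursion is on the last layer and stops before the rectifier, which is
  where each peeling step starts and ends.\<close>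

fun pre_act :: "(nat \<Rightarrow> nat \<Rightarrow> nat \<Rightarrow> real) \<Rightarrow> nat list \<Rightarrow> nat \<Rightarrow> (nat \<Rightarrow> real) \<Rightarrow> (nat \<Rightarrow> real)" where
  "pre_act W ds 0 x = affine_map (W 0) (ds ! 0) x"
| "pre_act W ds (Suc l) x = affine_map (W (Suc l)) (ds ! Suc l) (relu (pre_act W ds l x))"

lemma net_eval_snoc:
  assumes "Ts \<noteq> []" "length Ts < length ds"
  shows "net_eval (Ts @ [T]) ds x = affine_map T (ds ! length Ts) (relu (net_eval Ts ds x))"
  using assms
proof (induction Ts ds x rule: net_eval.induct)
  case (2 T' ds x)
  then show ?case by (cases ds) (auto simp: hd_conv_nth)
next
  case (3 T1 T2 Ts ds x)
  then show ?case by (cases ds) auto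
qed simp

lemma net_eval_eq_pre_act:
  assumes "k < length ds"
  shows "net_eval (map W [0..<Suc k]) ds x = pre_act W ds k x"
  using assms
proof (induction k)
  case 0
  then show ?case by (simp add: hd_conv_nth)
next
  case (Suc k)
  then show ?case
    using net_eval_snoc[of "map W [0..<Suc k]" ds "W (Suc k)" x] by simp
qed

text \<open>The pairing is linear, so the values of a neuron pair like the same combination of the
  constant 1 and the units below. Hoelder's inequality between the l1 norm of the column, bias
  included, and the maximum of the pairings gives the bound.\<close>

lemma pairing_affine_le:
  assumes "\<bar>pairing n \<epsilon> (\<lambda>_. 1)\<bar> \<le> B"
    and "\<And>m. m < a \<Longrightarrow> \<bar>pairing n \<epsilon> (\<lambda>i. y i m)\<bar> \<le> B"
    and "(\<Sum>i\<le>a. \<bar>M i j\<bar>) \<le> \<gamma>"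
  shows "\<bar>pairing n \<epsilon> (\<lambda>i. affine_map M a (y i) j)\<bar> \<le> \<gamma> * B"
proof -
  have B: "B \<ge> 0" using assms(1) by linarith
  have "pairing n \<epsilon> (\<lambda>i. affine_map M a (y i) j)
      = M 0 j * pairing n \<epsilon> (\<lambda>_. 1) + (\<Sum>i<n. \<Sum>m<a. \<epsilon> i * (M (Suc m) j * y i m))"
    by (simp add: pairing_def affine_map_def distrib_left sum.distrib sum_distrib_left mult.commute)
  also have "(\<Sum>i<n. \<Sum>m<a. \<epsilon> i * (M (Suc m) j * y i m))
      = (\<Sum>m<a. M (Suc m) j * pairing n \<epsilon> (\<lambda>i. y i m))"
    unfolding pairing_def sum_distrib_left by (subst sum.swap) (simp add: mult.left_commute)
  finally have "\<bar>pairing n \<epsilon> (\<lambda>i. affine_map M a (y i) j)\<bar>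
      \<le> \<bar>M 0 j * pairing n \<epsilon> (\<lambda>_. 1)\<bar> + (\<Sum>m<a. \<bar>M (Suc m) j * pairing n \<epsilon> (\<lambda>i. y i m)\<bar>)"
    by (auto intro: order_trans[OF abs_triangle_ineq] add_left_mono sum_abs)
  also have "\<dots> \<le> \<bar>M 0 j\<bar> * B + (\<Sum>m<a. \<bar>M (Suc m) j\<bar> * B)"
    unfolding abs_mult using assms(1,2) by (intro add_mono sum_mono mult_left_mono) auto
  also have "\<dots> = (\<Sum>i\<le>a. \<bar>M i j\<bar>) * B"
    by (simp add: sum.atMost_shift sum_distrib_right distrib_right)
  also have "\<dots> \<le> \<gamma> * B"
    using assms(3) B by (rule mult_right_mono)
  finally show ?thesis .
qed

section \<open>Peeling on a fixed sample\<close>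

text \<open>Of the norm constraints only the column sums are kept, so \<open>q\<close> no longer
  occurs. Positive widths make every layer nonempty, without which the maxima would be
  meaningless.\<close>

locale finite_relu_class =
  fixes P :: "(nat \<Rightarrow> nat \<Rightarrow> nat \<Rightarrow> real) set" and ds :: "nat list" and k n :: nat
    and c co :: real and x :: "nat \<Rightarrow> nat \<Rightarrow> real"
  assumes P: "finite P" "P \<noteq> {}"
    and width: "\<And>l. l \<le> Suc k \<Longrightarrow> ds ! l \<ge> 1"
    and c: "c > 0" and co: "co > 0" and n: "n > 0"
    and hidden: "\<And>W l j. W \<in> P \<Longrightarrow> l < k \<Longrightarrow> j < ds ! Suc l \<Longrightarrow> (\<Sum>i\<le>ds ! l. \<bar>W l i j\<bar>) \<le> c"
    and last: "\<And>W j. W \<in> P \<Longrightarrow> j < ds ! Suc k \<Longrightarrow> (\<Sum>i\<le>ds ! k. \<bar>W k i j\<bar>) \<le> co"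
    and input: "\<And>i m. i < n \<Longrightarrow> m < ds ! 0 \<Longrightarrow> \<bar>x i m\<bar> \<le> 1"
begin

text \<open>All neurons of all networks in one set. A neuron above is dominated by the maximum over
  this set whatever the number of its inputs, so hidden widths never enter a bound.\<close>

definition layer :: "nat \<Rightarrow> (nat \<Rightarrow> real) set" where
  "layer l = (\<lambda>(W, j). \<lambda>i. pre_act W ds l (x i) j) ` (P \<times> {..<ds ! Suc l})"

lemma finite_layer: "finite (layer l)"
  using P by (simp add: layer_def)

lemma layer_nonempty: "l \<le> k \<Longrightarrow> layer l \<noteq> {}"
  using P width[of "Suc l"] by (auto simp: layer_def lessThan_empty_iff)

definition inputs :: "(nat \<Rightarrow> real) set" where
  "inputs = (\<lambda>m i. x i m) ` {..<ds ! 0}"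

lemma hinge_avg_first_layer_le:
  assumes \<gamma>: "\<gamma> > 0" "\<And>W j. W \<in> P \<Longrightarrow> j < ds ! Suc 0 \<Longrightarrow> (\<Sum>i\<le>ds ! 0. \<bar>W 0 i j\<bar>) \<le> \<gamma>"
    and s: "s > 0" and \<theta>: "\<theta> > 0"
  shows "hinge_avg \<theta> n s (layer 0) \<le> excess \<theta> n (s * \<gamma>) + ds ! 0 * excess \<theta> n (s * \<gamma>)"
proof -
  have inp: "finite inputs" "inputs \<noteq> {}"
    using width[of 0] by (auto simp: inputs_def lessThan_empty_iff)
  have ex: "excess \<theta> n (s * \<gamma>) \<ge> 0"
    using \<theta> by (simp add: excess_def)
  have "hinge_avg \<theta> n s (layer 0) \<le> hinge_avg \<theta> n (s * \<gamma>) (insert (\<lambda>_. 1) inputs)"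
  proof (rule hinge_avg_hull_le)
    fix \<epsilon> v B
    assume v: "v \<in> layer 0" and B: "\<bar>pairing n \<epsilon> (\<lambda>_. 1)\<bar> \<le> B"
      "\<And>u. u \<in> inputs \<Longrightarrow> \<bar>pairing n \<epsilon> u\<bar> \<le> B"
    from v obtain W j where W: "W \<in> P" "j < ds ! Suc 0"
      and v: "v = (\<lambda>i. affine_map (W 0) (ds ! 0) (x i) j)"
      by (auto simp: layer_def)
    show "\<bar>pairing n \<epsilon> v\<bar> \<le> \<gamma> * B"
      unfolding v using B W \<gamma> by (intro pairing_affine_le) (auto simp: inputs_def)
  qed (use finite_layer layer_nonempty[of 0] inp s \<gamma> in auto)
  also have "\<dots> \<le> hinge_avg \<theta> n (s * \<gamma>) {\<lambda>_. 1} + hinge_avg \<theta> n (s * \<gamma>) inputs"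
    using inp by (rule hinge_avg_insert_le)
  also have "\<dots> \<le> excess \<theta> n (s * \<gamma>) + card inputs * excess \<theta> n (s * \<gamma>)"
    using inp n s \<gamma> \<theta> input
    by (intro add_mono hinge_avg_singleton_le hinge_avg_finite_le) (auto simp: inputs_def)
  also have "card inputs * excess \<theta> n (s * \<gamma>) \<le> ds ! 0 * excess \<theta> n (s * \<gamma>)"
    using ex card_image_le[of "{..<ds ! 0}" "\<lambda>m i. x i m"] by (intro mult_right_mono) (auto simp: inputs_def)
  finally show ?thesis by simp
qed

text \<open>Three moves: the hull property puts the norm into the scale, the bias splits off as a
  single tail, and contraction removes the rectifier at the price of a factor 2.\<close>

lemma hinge_avg_next_layer_le:
  assumes \<gamma>: "\<gamma> > 0" "\<And>W j. W \<in> P \<Longrightarrow> j < ds ! Suc (Suc l) \<Longrightarrow> (\<Sum>i\<le>ds ! Suc l. \<bar>W (Suc l) i j\<bar>) \<le> \<gamma>"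
    and s: "s > 0" and \<theta>: "\<theta> > 0" and l: "l < k"
  shows "hinge_avg \<theta> n s (layer (Suc l)) \<le> excess \<theta> n (s * \<gamma>) + 2 * hinge_avg \<theta> n (s * \<gamma>) (layer l)"
proof -
  have L: "finite (layer l)" "layer l \<noteq> {}"
    using finite_layer layer_nonempty[of l] l by auto
  have "hinge_avg \<theta> n s (layer (Suc l)) \<le> hinge_avg \<theta> n (s * \<gamma>) (insert (\<lambda>_. 1) (relu ` layer l))"
  proof (rule hinge_avg_hull_le)
    fix \<epsilon> v B
    assume v: "v \<in> layer (Suc l)" and B: "\<bar>pairing n \<epsilon> (\<lambda>_. 1)\<bar> \<le> B"
      "\<And>u. u \<in> relu ` layer l \<Longrightarrow> \<bar>pairing n \<epsilon> u\<bar> \<le> B"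
    from v obtain W j where W: "W \<in> P" "j < ds ! Suc (Suc l)"
      and v: "v = (\<lambda>i. affine_map (W (Suc l)) (ds ! Suc l) (relu (pre_act W ds l (x i))) j)"
      by (auto simp: layer_def)
    have "\<bar>pairing n \<epsilon> (\<lambda>i. relu (pre_act W ds l (x i)) m)\<bar> \<le> B" if "m < ds ! Suc l" for m
    proof -
      have "(\<lambda>i. relu (pre_act W ds l (x i)) m) = relu (\<lambda>i. pre_act W ds l (x i) m)"
        by (simp add: relu_def)
      moreover have "(\<lambda>i. pre_act W ds l (x i) m) \<in> layer l"
        using W that by (auto simp: layer_def)
      ultimately show ?thesis using B by simp
    qed
    then show "\<bar>pairing n \<epsilon> v\<bar> \<le> \<gamma> * B"
      unfolding v using B W \<gamma> by (intro pairing_affine_le) auto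
  qed (use finite_layer layer_nonempty[of "Suc l"] l L s \<gamma> in auto)
  also have "\<dots> \<le> hinge_avg \<theta> n (s * \<gamma>) {\<lambda>_. 1} + hinge_avg \<theta> n (s * \<gamma>) (relu ` layer l)"
    using L by (intro hinge_avg_insert_le) auto
  also have "\<dots> \<le> excess \<theta> n (s * \<gamma>) + 2 * hinge_avg \<theta> n (s * \<gamma>) (layer l)"
    using L n s \<gamma> \<theta> by (intro add_mono hinge_avg_singleton_le hinge_avg_relu_le) auto
  finally show ?thesis .
qed

text \<open>The recursion unrolled: summand \<open>i\<close> is the bias of layer
  \<open>l - i\<close>, which lies below \<open>i\<close> rectifiers and above which, itself
  included, \<open>i + 1\<close> norms have accumulated. The last term collects the inputs.\<close>

lemma hinge_avg_hidden_layer_le: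
  assumes "\<theta> > 0" "s > 0" "l < k"
  shows "hinge_avg \<theta> n s (layer l)
    \<le> (\<Sum>i\<le>l. 2 ^ i * excess \<theta> n (s * c ^ Suc i)) + 2 ^ l * real (ds ! 0) * excess \<theta> n (s * c ^ Suc l)"
  using assms(2,3)
proof (induction l arbitrary: s)
  case 0
  then show ?case
    using hinge_avg_first_layer_le[of c s \<theta>] assms(1) c hidden by simp
next
  case (Suc l)
  have "hinge_avg \<theta> n s (layer (Suc l)) \<le> excess \<theta> n (s * c) + 2 * hinge_avg \<theta> n (s * c) (layer l)"
    using Suc.prems assms(1) c hidden by (intro hinge_avg_next_layer_le) auto
  also have "\<dots> \<le> excess \<theta> n (s * c) + 2 * ((\<Sum>i\<le>l. 2 ^ i * excess \<theta> n (s * c * c ^ Suc i))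
      + 2 ^ l * real (ds ! 0) * excess \<theta> n (s * c * c ^ Suc l))"
    using Suc.IH[of "s * c"] Suc.prems c by simp
  also have "\<dots> = (\<Sum>i\<le>Suc l. 2 ^ i * excess \<theta> n (s * c ^ Suc i))
      + 2 ^ Suc l * real (ds ! 0) * excess \<theta> n (s * c ^ Suc (Suc l))"
    by (subst sum.atMost_Suc_shift) (simp add: sum_distrib_left algebra_simps)
  finally show ?case .
qed

text \<open>The outermost norm is \<open>co\<close> instead of \<open>c\<close>, so every scale is
  one power of \<open>c\<close> lower than for a hidden layer. For \<open>k = 0\<close> the output
  layer is at the same time the first one.\<close>

lemma hinge_avg_output_layer_le:
  assumes "\<theta> > 0"
  shows "hinge_avg \<theta> n 1 (layer k)
    \<le> (\<Sum>i\<le>k. 2 ^ i * excess \<theta> n (co * c ^ i)) + 2 ^ k * real (ds ! 0) * excess \<theta> n (co * c ^ k)"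
proof (cases k)
  case 0
  then show ?thesis
    using hinge_avg_first_layer_le[of co 1 \<theta>] assms co last by simp
next
  case (Suc l)
  have "hinge_avg \<theta> n 1 (layer (Suc l)) \<le> excess \<theta> n (1 * co) + 2 * hinge_avg \<theta> n (1 * co) (layer l)"
    using Suc assms co last by (intro hinge_avg_next_layer_le) auto
  also have "\<dots> \<le> excess \<theta> n co + 2 * ((\<Sum>i\<le>l. 2 ^ i * excess \<theta> n (co * c ^ Suc i))
      + 2 ^ l * real (ds ! 0) * excess \<theta> n (co * c ^ Suc l))"
    using hinge_avg_hidden_layer_le[of \<theta> co l] Suc assms co by simp
  also have "\<dots> = (\<Sum>i\<le>Suc l. 2 ^ i * excess \<theta> n (co * c ^ i))
      + 2 ^ Suc l * real (ds ! 0) * excess \<theta> n (co * c ^ Suc l)"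
    by (subst sum.atMost_Suc_shift) (simp add: sum_distrib_left algebra_simps)
  finally show ?thesis
    using Suc by simp
qed

lemma sign_avg_output_le:
  assumes "\<theta> > 0"
  shows "sign_avg n (\<lambda>\<epsilon>. MAX W\<in>P. pairing n \<epsilon> (\<lambda>i. pre_act W ds k (x i) 0))
    \<le> \<theta> + ((\<Sum>i\<le>k. 2 ^ i * excess \<theta> n (co * c ^ i)) + 2 ^ k * real (ds ! 0) * excess \<theta> n (co * c ^ k))"
proof -
  have "sign_avg n (\<lambda>\<epsilon>. MAX W\<in>P. pairing n \<epsilon> (\<lambda>i. pre_act W ds k (x i) 0))
      \<le> sign_avg n (\<lambda>\<epsilon>. \<theta> + (MAX v\<in>layer k. max (1 * \<bar>pairing n \<epsilon> v\<bar> - \<theta>) 0))"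
  proof (rule sign_avg_mono)
    fix \<epsilon>
    have "pairing n \<epsilon> v \<le> \<theta> + (MAX v\<in>layer k. max (1 * \<bar>pairing n \<epsilon> v\<bar> - \<theta>) 0)" if "v \<in> layer k" for v
    proof -
      have "max (1 * \<bar>pairing n \<epsilon> v\<bar> - \<theta>) 0 \<le> (MAX v\<in>layer k. max (1 * \<bar>pairing n \<epsilon> v\<bar> - \<theta>) 0)"
        using that finite_layer by (intro Max_ge) auto
      then show ?thesis by linarith
    qed
    moreover have "(\<lambda>i. pre_act W ds k (x i) 0) \<in> layer k" if "W \<in> P" for W
      using that width[of "Suc k"] by (force simp: layer_def)
    ultimately show "(MAX W\<in>P. pairing n \<epsilon> (\<lambda>i. pre_act W ds k (x i) 0))
        \<le> \<theta> + (MAX v\<in>layer k. max (1 * \<bar>pairing n \<epsilon> v\<bar> - \<theta>) 0)"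
      using P by (intro Max.boundedI) auto
  qed
  also have "\<dots> = \<theta> + hinge_avg \<theta> n 1 (layer k)"
    by (simp add: sign_avg_add sign_avg_const hinge_avg_def)
  finally show ?thesis
    using hinge_avg_output_layer_le[OF assms] by linarith
qed

end

section \<open>Choosing the threshold\<close>

text \<open>\<open>excess\<close> made dimensionless: with
  \<open>\<theta> = sqrt n * co * \<tau>\<close> and scale \<open>co * r\<close>, the common factor
  \<open>sqrt n * co\<close> comes out.\<close>

definition gauss_tail :: "real \<Rightarrow> real \<Rightarrow> real" where
  "gauss_tail \<tau> r = 2 * r\<^sup>2 / (exp 1 * \<tau>) * exp (- (\<tau> / r)\<^sup>2 / 2)"

lemma excess_scale:
  assumes "n > 0" "co > 0" "\<tau> > 0" "r > 0"
  shows "excess (sqrt n * co * \<tau>) n (co * r) = sqrt n * co * gauss_tail \<tau> r"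
proof -
  have s: "sqrt n > 0" using assms by simp
  have n: "real n = sqrt n * sqrt n" by simp
  have "(sqrt n * co * \<tau>)\<^sup>2 / (2 * ((co * r)\<^sup>2 * n)) = (\<tau> / r)\<^sup>2 / 2"
    using assms by (simp add: field_simps power_mult_distrib)
  moreover have "2 * ((co * r)\<^sup>2 * n) / (exp 1 * (sqrt n * co * \<tau>)) = sqrt n * co * (2 * r\<^sup>2 / (exp 1 * \<tau>))"
    by (subst n) (use s assms in \<open>simp add: divide_simps power2_eq_square del: real_sqrt_mult_self\<close>)
  ultimately show ?thesis
    by (simp add: excess_def gauss_tail_def)
qed

text \<open>Two lower bounds on \<open>\<tau>\<close> do separate work:
  \<open>\<rho> * a \<le> \<tau>\<close> bounds the factor \<open>r\<^sup>2 / \<tau>\<close> by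
  \<open>\<rho> / a\<close>, while \<open>t * r \<le> \<tau>\<close> bounds the exponential.\<close>

lemma gauss_tail_le:
  assumes r: "0 < r" "r \<le> \<rho>" and a: "0 < a" "\<rho> * a \<le> \<tau>" and t: "0 \<le> t" "t * r \<le> \<tau>"
  shows "gauss_tail \<tau> r \<le> 2 * \<rho> / (exp 1 * a) * exp (- t\<^sup>2 / 2)"
  unfolding gauss_tail_def
proof (intro mult_mono)
  have \<tau>: "\<tau> > 0" using r a by (smt (verit) mult_pos_pos)
  have "r\<^sup>2 * a \<le> \<rho>\<^sup>2 * a"
    using r a by (intro mult_right_mono power_mono) auto
  also have "\<dots> \<le> \<rho> * \<tau>"
    using r a by (simp add: power2_eq_square mult.assoc)
  finally have "r\<^sup>2 / \<tau> \<le> \<rho> / a"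
    using \<tau> a by (simp add: divide_simps)
  then have "2 / exp 1 * (r\<^sup>2 / \<tau>) \<le> 2 / exp 1 * (\<rho> / a)"
    by (intro mult_left_mono) auto
  then show "2 * r\<^sup>2 / (exp 1 * \<tau>) \<le> 2 * \<rho> / (exp 1 * a)"
    by simp
  have "t\<^sup>2 \<le> (\<tau> / r)\<^sup>2"
    using t r by (intro power_mono) (auto simp: divide_simps)
  then show "exp (- (\<tau> / r)\<^sup>2 / 2) \<le> exp (- t\<^sup>2 / 2)" by simp
qed (use r a in auto)

lemma sum_power2_le: "(\<Sum>i\<le>k. 2 ^ i :: real) \<le> 2 ^ Suc k"
  by (induction k) auto

text \<open>All scales are replaced by \<open>C\<close>, the largest of the powers
  \<open>c ^ i\<close>, which is attained at \<open>i = 0\<close> or \<open>i = k\<close>. A single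
  quantile \<open>t\<close> then makes every tail small compared with the total weight.\<close>

lemma peeled_bound_uniform:
  fixes c :: real and k m :: nat
  assumes c: "c > 0" and m: "m \<ge> 1"
  defines "C \<equiv> max 1 (c ^ k)" and "L \<equiv> ln (2 ^ Suc k * (real m + 2))"
  defines "\<tau> \<equiv> C * sqrt (2 * L)"
  shows "\<tau> > 0" and "\<tau> + ((\<Sum>i\<le>k. 2 ^ i * gauss_tail \<tau> (c ^ i)) + 2 ^ k * real m * gauss_tail \<tau> (c ^ k))
    \<le> 2 * max 1 (c ^ k) * sqrt (real k + 2 + ln (real m + 1))"
proof -
  define t where "t = sqrt (2 * L)"
  \<comment> \<open>Twice a bound on the total weight: the powers of 2 sum to at most
    \<open>2 ^ Suc k\<close>, and the inputs add \<open>2 ^ k * m\<close>. The choice of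
    \<open>t\<close> gives \<open>exp (- t\<^sup>2 / 2) = 1 / N\<close>.\<close>
  define N :: real where "N = 2 ^ Suc k * (real m + 2)"
  have "(1::real) \<le> 2 ^ k" by simp
  then have "(2::real) \<le> 2 ^ Suc k" by simp
  then have N: "N \<ge> 2 * 3"
    unfolding N_def using m by (intro mult_mono) auto
  have L: "L > 1"
  proof -
    have "ln (2 ^ 2) \<le> ln N" using N by simp
    moreover have "ln (2 ^ 2) = 2 * ln (2::real)" by (subst ln_realpow) auto
    ultimately show ?thesis
      unfolding L_def N_def[symmetric] using ln2_ge_two_thirds by linarith
  qed
  have t: "t > 0" "t\<^sup>2 = 2 * L" using L by (auto simp: t_def)
  have C: "C \<ge> 1" by (simp add: C_def)
  show \<tau>: "\<tau> > 0" using C t by (simp add: \<tau>_def flip: t_def)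
  have cC: "c ^ i \<le> C" if "i \<le> k" for i
  proof (cases "c \<le> 1")
    case True
    then show ?thesis using c by (simp add: C_def power_le_one le_max_iff_disj)
  next
    case False
    then show ?thesis using that by (auto simp: C_def le_max_iff_disj intro!: power_increasing)
  qed
  have expt: "exp (- t\<^sup>2 / 2) = 1 / N"
  proof -
    have "- t\<^sup>2 / 2 = - ln N" by (simp add: t(2) L_def N_def)
    then have "exp (- t\<^sup>2 / 2) = inverse (exp (ln N))"
      by (simp only: exp_minus)
    then show ?thesis using N by (simp only: inverse_eq_divide) simp
  qed
  define K where "K = 2 * C / (exp 1 * t) * (1 / N)"
  have K: "K \<ge> 0" using C t N by (simp add: K_def)
  have tail: "gauss_tail \<tau> (c ^ i) \<le> K" if "i \<le> k" for i
  proof -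
    have "t * c ^ i \<le> \<tau>"
      using mult_left_mono[OF cC[OF that], of t] t by (simp add: \<tau>_def t_def mult.commute)
    then show ?thesis
      unfolding K_def expt[symmetric] using cC[OF that] c t
      by (intro gauss_tail_le) (auto simp: \<tau>_def t_def)
  qed
  have "(\<Sum>i\<le>k. 2 ^ i * gauss_tail \<tau> (c ^ i)) \<le> (\<Sum>i\<le>k. 2 ^ i * K)"
    by (intro sum_mono mult_left_mono tail) auto
  also have "\<dots> \<le> 2 ^ Suc k * K"
    unfolding sum_distrib_right[symmetric] using K by (intro mult_right_mono sum_power2_le)
  finally have "(\<Sum>i\<le>k. 2 ^ i * gauss_tail \<tau> (c ^ i)) + 2 ^ k * real m * gauss_tail \<tau> (c ^ k)
      \<le> 2 ^ Suc k * K + 2 ^ k * real m * K"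
    by (intro add_mono mult_left_mono tail) auto
  also have "\<dots> = N * K / 2"
    by (simp add: N_def algebra_simps)
  also have "\<dots> = C * (1 / (exp 1 * t))"
    using N by (simp add: K_def)
  also have "\<dots> \<le> C * (1 / (2 * t))"
    using C t exp_ge_add_one_self[of 1] by (intro mult_left_mono divide_left_mono) auto
  finally have "\<tau> + ((\<Sum>i\<le>k. 2 ^ i * gauss_tail \<tau> (c ^ i)) + 2 ^ k * real m * gauss_tail \<tau> (c ^ k))
      \<le> C * (t + 1 / (2 * t))"
    by (simp add: \<tau>_def t_def distrib_left)
  \<comment> \<open>The square is \<open>2 * L\<close> plus the cross term 1 plus a term below 1.
    With \<open>m + 2 \<le> 2 * (m + 1)\<close> one more factor 2 moves into the power, which is why
    \<open>k + 2\<close> appears.\<close>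
  also have "t + 1 / (2 * t) \<le> 2 * sqrt (real k + 2 + ln (real m + 1))"
  proof -
    have lnm: "ln (real m + 1) \<ge> 0" by simp
    have "(1 / (2 * t))\<^sup>2 \<le> 1"
      using t L by (simp add: power_divide power_mult_distrib)
    then have 1: "(t + 1 / (2 * t))\<^sup>2 \<le> 2 * L + 2"
      using t by (simp add: power2_sum)
    have 2: "L \<le> (k + 2) * ln 2 + ln (real m + 1)"
    proof -
      have "N \<le> 2 ^ (k + 2) * (real m + 1)"
        by (simp add: N_def algebra_simps)
      then have "ln N \<le> ln (2 ^ (k + 2) * (real m + 1))"
        using N by simp
      also have "\<dots> = (k + 2) * ln 2 + ln (real m + 1)"
        by (subst ln_mult) (simp_all only: ln_realpow zero_less_numeral, auto)
      finally show ?thesis by (simp add: L_def N_def)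
    qed
    have 3: "(k + 2) * ln 2 \<le> real k + 2"
    proof -
      have "(real k + 2) * ln 2 \<le> (real k + 2) * 1"
        using ln_2_less_1 by (intro mult_left_mono) auto
      then show ?thesis by (simp add: add.commute)
    qed
    have "(t + 1 / (2 * t))\<^sup>2 \<le> 4 * (real k + 2 + ln (real m + 1))"
      using 1 2 3 lnm of_nat_0_le_iff[of k, where 'a = real] by argo
    then have "t + 1 / (2 * t) \<le> sqrt (4 * (real k + 2 + ln (real m + 1)))"
      by (rule real_le_rsqrt)
    then show ?thesis
      unfolding real_sqrt_mult by simp
  qed
  finally show "\<tau> + ((\<Sum>i\<le>k. 2 ^ i * gauss_tail \<tau> (c ^ i)) + 2 ^ k * real m * gauss_tail \<tau> (c ^ k))
    \<le> 2 * max 1 (c ^ k) * sqrt (real k + 2 + ln (real m + 1))"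
    using C by (simp add: C_def mult_left_mono mult.left_commute)
qed

text \<open>With \<open>x = (k + 1) * ln 2\<close> one has \<open>a = sqrt (2 * x)\<close>, and
  since \<open>ln 16 = 4 * ln 2\<close> the target is \<open>sqrt (4 * x)\<close>. The gap between
  \<open>2 * x\<close> and \<open>4 * x\<close> pays for the remainder \<open>1 / a\<close> once
  \<open>x \<ge> 4 / 3\<close>, that is for positive \<open>k\<close>. For \<open>k = 0\<close> the
  gap is too small, and the summand with \<open>d = S\<close> doubles the target.\<close>

lemma sqrt_log2_overhead_le:
  fixes k :: nat and S d :: real
  assumes S: "S \<ge> 1" and d: "d \<ge> 0" and zero: "k = 0 \<Longrightarrow> S = d"
  defines "a \<equiv> sqrt (2 * ((real k + 1) * ln 2))"
  shows "S * (a + 1 / a) \<le> S * sqrt ((real k + 1) * ln 16) + d * sqrt ((real k + 1) * ln 16)"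
proof -
  define x where "x = (real k + 1) * ln 2"
  have x: "x \<ge> 2 / 3" "k \<noteq> 0 \<Longrightarrow> x \<ge> 4 / 3"
  proof -
    have "1 * (2 / 3) \<le> x"
      unfolding x_def using ln2_ge_two_thirds by (intro mult_mono) auto
    then show "x \<ge> 2 / 3" by simp
    assume "k \<noteq> 0"
    then have "2 * (2 / 3) \<le> x"
      unfolding x_def using ln2_ge_two_thirds by (intro mult_mono) auto
    then show "x \<ge> 4 / 3" by simp
  qed
  have a: "a > 0" "a\<^sup>2 = 2 * x" using x by (auto simp: a_def simp flip: x_def)
  have "ln (16::real) = ln (2 ^ 4)" by simp
  also have "\<dots> = 4 * ln 2" by (subst ln_realpow) auto
  finally have l16: "sqrt ((real k + 1) * ln 16) = sqrt (4 * x)"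
    by (simp add: x_def)
  have sq: "(a + 1 / a)\<^sup>2 = 2 * x + 2 + 1 / (2 * x)"
    using a by (simp add: power2_sum power_divide)
  show ?thesis
  proof (cases "k = 0")
    case True
    have "1 / (2 * x) \<le> 1"
      using x by simp
    then have "(a + 1 / a)\<^sup>2 \<le> 4 * (4 * x)"
      unfolding sq using x by linarith
    then have "a + 1 / a \<le> sqrt (4 * (4 * x))"
      by (rule real_le_rsqrt)
    then have "a + 1 / a \<le> 2 * sqrt (4 * x)"
      by (simp add: real_sqrt_mult)
    then have "S * (a + 1 / a) \<le> S * (2 * sqrt (4 * x))"
      using S by (intro mult_left_mono) auto
    then show ?thesis using zero[OF True] by (simp add: l16)
  next
    case False
    have "1 / (2 * x) \<le> 1 / (2 * (4 / 3))"
      using x(2)[OF False] by (intro divide_left_mono) auto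
    then have "1 / (2 * x) \<le> 3 / 8" by simp
    then have "(a + 1 / a)\<^sup>2 \<le> 4 * x"
      unfolding sq using x(2)[OF False] by linarith
    then have "a + 1 / a \<le> sqrt (4 * x)"
      by (rule real_le_rsqrt)
    then have "S * (a + 1 / a) \<le> S * sqrt (4 * x)"
      using S by (intro mult_left_mono) auto
    moreover have "0 \<le> d * sqrt (4 * x)"
      using d x by simp
    ultimately show ?thesis by (simp add: l16)
  qed
qed

text \<open>The two sources of weight are absorbed separately:
  \<open>sqrt (2 * ((real k + 1) * ln 2))\<close> cancels the powers of 2 at every scale and is
  multiplied by \<open>S\<close>, while \<open>sqrt (2 * ln (2 * real m))\<close> cancels the number
  of inputs, which occurs only at scale \<open>c ^ k\<close>, and is multiplied by
  \<open>c ^ k\<close> alone.\<close>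

lemma peeled_bound_layerwise:
  fixes c :: real and k m :: nat
  assumes c: "c > 0" and m: "m \<ge> 1"
  defines "S \<equiv> \<Sum>i\<le>k. c ^ i"
  defines "\<tau> \<equiv> S * sqrt (2 * ((real k + 1) * ln 2)) + c ^ k * sqrt (2 * ln (2 * real m))"
  shows "\<tau> > 0" and "\<tau> + ((\<Sum>i\<le>k. 2 ^ i * gauss_tail \<tau> (c ^ i)) + 2 ^ k * real m * gauss_tail \<tau> (c ^ k))
    \<le> sqrt ((real k + 1) * ln 16) * (\<Sum>i\<le>k. c ^ i)
      + c ^ k * (sqrt (2 * ln (2 * real m)) + sqrt ((real k + 1) * ln 16))"
proof -
  define a where "a = sqrt (2 * ((real k + 1) * ln 2))"
  define b where "b = sqrt (2 * ln (2 * real m))"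
  have a: "a > 0" "a\<^sup>2 = 2 * ((real k + 1) * ln 2)" by (auto simp: a_def)
  have b: "b \<ge> 0" "b\<^sup>2 = 2 * ln (2 * real m)" using m by (auto simp: b_def)
  have cS: "c ^ i \<le> S" if "i \<le> k" for i
    unfolding S_def using that c by (intro member_le_sum) auto
  have S: "S \<ge> 1" using cS[of 0] by simp
  have \<tau>: "\<tau> = S * a + c ^ k * b" by (simp add: \<tau>_def a_def b_def)
  show "\<tau> > 0" unfolding \<tau> using S a b c by (intro add_pos_nonneg) auto
  have Sa: "S * a \<le> \<tau>" unfolding \<tau> using b c by simp
  have expa: "exp (- a\<^sup>2 / 2) = 1 / 2 ^ Suc k"
  proof -
    have "- a\<^sup>2 / 2 = - (real (Suc k) * ln 2)"
      by (simp add: a(2) add.commute)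
    then have "exp (- a\<^sup>2 / 2) = inverse (exp (real (Suc k) * ln 2))"
      by (simp only: exp_minus)
    also have "exp (real (Suc k) * ln 2) = (2::real) ^ Suc k"
      by (simp only: exp_of_nat_mult exp_ln[OF zero_less_numeral])
    finally show ?thesis by (simp only: inverse_eq_divide)
  qed
  have expb: "exp (- b\<^sup>2 / 2) = 1 / (2 * real m)"
  proof -
    have "- b\<^sup>2 / 2 = - ln (2 * real m)" by (simp add: b(2))
    then have "exp (- b\<^sup>2 / 2) = inverse (exp (ln (2 * real m)))"
      by (simp only: exp_minus)
    then show ?thesis using m by (simp only: inverse_eq_divide) simp
  qed
  define K where "K = 2 * S / (exp 1 * a)"
  have K: "K \<ge> 0" using S a by (simp add: K_def)
  have tail: "gauss_tail \<tau> (c ^ i) \<le> K * (1 / 2 ^ Suc k)" if "i \<le> k" for i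
  proof -
    have "a * c ^ i \<le> \<tau>"
      by (rule order_trans[OF mult_left_mono[OF cS[OF that], of a]]) (use a Sa in \<open>simp_all add: mult.commute\<close>)
    then show ?thesis
      unfolding K_def expa[symmetric] using cS[OF that] c a Sa
      by (intro gauss_tail_le) auto
  qed
  \<comment> \<open>At the deepest scale \<open>\<tau>\<close> exceeds
    \<open>(a + b) * c ^ k\<close>, and the cross term in \<open>(a + b)\<^sup>2\<close> is
    nonnegative, so the two exponential savings multiply.\<close>
  have last: "gauss_tail \<tau> (c ^ k) \<le> K * (1 / 2 ^ Suc k * (1 / (2 * real m)))"
  proof -
    have "c ^ k * a \<le> S * a"
      using cS[of k] a by (intro mult_right_mono) auto
    then have "(a + b) * c ^ k \<le> \<tau>"
      unfolding \<tau> by (simp add: algebra_simps)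
    then have "gauss_tail \<tau> (c ^ k) \<le> K * exp (- (a + b)\<^sup>2 / 2)"
      unfolding K_def using cS[of k] c a b Sa by (intro gauss_tail_le) auto
    also have "exp (- (a + b)\<^sup>2 / 2) \<le> exp (- a\<^sup>2 / 2 + - b\<^sup>2 / 2)"
      using a b by (simp add: power2_sum)
    also have "\<dots> = 1 / 2 ^ Suc k * (1 / (2 * real m))"
      unfolding exp_add expa expb ..
    finally show ?thesis using K by (simp add: mult_left_mono)
  qed
  have "(\<Sum>i\<le>k. 2 ^ i * gauss_tail \<tau> (c ^ i)) \<le> (\<Sum>i\<le>k. 2 ^ i * (K * (1 / 2 ^ Suc k)))"
    by (intro sum_mono mult_left_mono tail) auto
  also have "\<dots> \<le> 2 ^ Suc k * (K * (1 / 2 ^ Suc k))"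
    unfolding sum_distrib_right[symmetric] using K by (intro mult_right_mono sum_power2_le) auto
  finally have "(\<Sum>i\<le>k. 2 ^ i * gauss_tail \<tau> (c ^ i)) + 2 ^ k * real m * gauss_tail \<tau> (c ^ k)
      \<le> 2 ^ Suc k * (K * (1 / 2 ^ Suc k)) + 2 ^ k * real m * (K * (1 / 2 ^ Suc k * (1 / (2 * real m))))"
    by (intro add_mono mult_left_mono last) auto
  \<comment> \<open>The biases contribute at most \<open>K\<close> and the inputs
    \<open>K / 4\<close>; together \<open>5 / 2 / exp 1\<close> times \<open>S / a\<close>. The next
    step uses \<open>exp 1 \<ge> 1 + 1 + 1 / 2\<close>.\<close>
  also have "\<dots> = S * (5 / 2 / exp 1 * (1 / a))"
    using m a by (simp add: K_def field_simps)
  also have "\<dots> \<le> S * (1 * (1 / a))"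
    using S a exp_lower_Taylor_quadratic[of 1] by (intro mult_left_mono mult_right_mono) auto
  finally have "\<tau> + ((\<Sum>i\<le>k. 2 ^ i * gauss_tail \<tau> (c ^ i)) + 2 ^ k * real m * gauss_tail \<tau> (c ^ k))
      \<le> S * (a + 1 / a) + c ^ k * b"
    by (simp add: \<tau> distrib_left)
  also have "S * (a + 1 / a) \<le> S * sqrt ((real k + 1) * ln 16) + c ^ k * sqrt ((real k + 1) * ln 16)"
    unfolding a_def using S c by (intro sqrt_log2_overhead_le) (auto simp: S_def)
  finally show "\<tau> + ((\<Sum>i\<le>k. 2 ^ i * gauss_tail \<tau> (c ^ i)) + 2 ^ k * real m * gauss_tail \<tau> (c ^ k))
    \<le> sqrt ((real k + 1) * ln 16) * (\<Sum>i\<le>k. c ^ i)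
      + c ^ k * (sqrt (2 * ln (2 * real m)) + sqrt ((real k + 1) * ln 16))"
    by (simp add: S_def b_def algebra_simps)
qed

section \<open>Bounded differences and symmetrization\<close>

lemma Max_le_Max_add:
  fixes f g :: "'h \<Rightarrow> real"
  assumes "finite H" "H \<noteq> {}" "\<And>h. h \<in> H \<Longrightarrow> f h \<le> g h + d"
  shows "(MAX h\<in>H. f h) \<le> (MAX h\<in>H. g h) + d"
proof (rule Max.boundedI)
  fix y assume "y \<in> f ` H"
  then obtain h where h: "h \<in> H" "y = f h" by auto
  have "g h \<le> (MAX h\<in>H. g h)"
    using assms(1) h by (intro Max_ge) auto
  then show "y \<le> (MAX h\<in>H. g h) + d"
    using assms(3)[OF h(1)] h(2) by linarith
qed (use assms in auto)

lemma abs_Max_le: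
  fixes f :: "'h \<Rightarrow> real"
  assumes "finite H" "H \<noteq> {}" "\<And>h. h \<in> H \<Longrightarrow> \<bar>f h\<bar> \<le> B"
  shows "\<bar>MAX h\<in>H. f h\<bar> \<le> B"
proof -
  have "(MAX h\<in>H. f h) \<in> f ` H" using assms by (intro Max_in) auto
  then show ?thesis using assms(3) by auto
qed

lemma (in prob_space) integrable_bounded:
  fixes f :: "'a \<Rightarrow> real"
  assumes "f \<in> borel_measurable M" "\<And>x. x \<in> space M \<Longrightarrow> \<bar>f x\<bar> \<le> B"
  shows "integrable M f"
  using assms by (intro integrable_const_bound[where B = B]) auto

lemma (in prob_space) abs_expectation_le:
  fixes f :: "'a \<Rightarrow> real"
  assumes "f \<in> borel_measurable M" "\<And>x. x \<in> space M \<Longrightarrow> \<bar>f x\<bar> \<le> B"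
  shows "\<bar>expectation f\<bar> \<le> B"
proof -
  have i: "integrable M f" using assms by (rule integrable_bounded)
  have "\<bar>expectation f\<bar> \<le> expectation (\<lambda>x. \<bar>f x\<bar>)"
    by (rule integral_abs_bound)
  also have "\<dots> \<le> B"
    using i assms(2) by (intro integral_le_const) auto
  finally show ?thesis .
qed

section \<open>Bounded differences: McDiarmid's inequality\<close>

text \<open>Hoeffding's lemma asks for an interval of values; the infimum of \<open>f\<close> and
  the oscillation bound supply one of length \<open>d\<close> without knowing where it lies.\<close>

lemma (in prob_space) hoeffding_oscillation:
  fixes f :: "'a \<Rightarrow> real"
  assumes f: "f \<in> borel_measurable M" and l: "l > 0"
    and osc: "\<And>x y. x \<in> space M \<Longrightarrow> y \<in> space M \<Longrightarrow> \<bar>f x - f y\<bar> \<le> d"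
  shows "expectation (\<lambda>x. exp (l * f x)) \<le> exp (l * expectation f + l\<^sup>2 * d\<^sup>2 / 8)"
proof -
  define a where "a = Inf (f ` space M)"
  have ne: "space M \<noteq> {}" by (rule not_empty)
  then obtain x0 where x0: "x0 \<in> space M" by auto
  have bdd: "bdd_below (f ` space M)"
    using osc[OF x0] by (intro bdd_belowI[of _ "f x0 - d"]) force
  have low: "a \<le> f x" if "x \<in> space M" for x
    unfolding a_def using that bdd by (intro cInf_lower) auto
  have up: "f x \<le> a + d" if "x \<in> space M" for x
  proof -
    have "f x - d \<le> a"
      unfolding a_def using ne osc[OF that] by (intro cInf_greatest) force+
    then show ?thesis by simp
  qed
  interpret interval_bounded_random_variable M f a "a + d"
    using f low up by unfold_locales auto
  define \<mu> where "\<mu> = expectation f"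
  have bnd: "\<bar>f x\<bar> \<le> \<bar>a\<bar> + \<bar>a + d\<bar>" if "x \<in> space M" for x
    using low[OF that] up[OF that] by linarith
  have "integrable M (\<lambda>x. exp (l * (f x - \<mu>)))"
  proof (rule integrable_bounded)
    fix x assume "x \<in> space M"
    then show "\<bar>exp (l * (f x - \<mu>))\<bar> \<le> exp (l * (\<bar>a\<bar> + \<bar>a + d\<bar> - \<mu>))"
      using bnd[of x] l by simp
  qed (use f in measurable)
  then have "ennreal (expectation (\<lambda>x. exp (l * (f x - \<mu>)))) = (\<integral>\<^sup>+x. exp (l * (f x - \<mu>)) \<partial>M)"
    by (subst nn_integral_eq_integral) auto
  also have "\<dots> \<le> ennreal (exp (l\<^sup>2 * (a + d - a)\<^sup>2 / 8))"
    unfolding \<mu>_def using l by (rule Hoeffdings_lemma_nn_integral)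
  finally have "expectation (\<lambda>x. exp (l * (f x - \<mu>))) \<le> exp (l\<^sup>2 * d\<^sup>2 / 8)"
    by simp
  moreover have "expectation (\<lambda>x. exp (l * f x)) = exp (l * \<mu>) * expectation (\<lambda>x. exp (l * (f x - \<mu>)))"
    by (simp flip: integral_mult_right_zero exp_add add: algebra_simps)
  ultimately show ?thesis
    by (simp add: exp_add \<mu>_def)
qed

text \<open>Induction on the coordinates in place of a martingale: integrating out one coordinate
  costs the factor \<open>exp (l\<^sup>2 * d\<^sup>2 / 8)\<close> and leaves a function
  \<open>\<Psi>\<close> of the others with the same mean, the same bound and the same
  differences.\<close>

lemma (in prob_space) mgf_bounded_differences:
  fixes \<Phi> :: "('i \<Rightarrow> 'a) \<Rightarrow> real"
  assumes I: "finite I" and l: "l > 0"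
    and meas: "\<Phi> \<in> borel_measurable (PiM I (\<lambda>_. M))"
    and bnd: "\<And>S. S \<in> space (PiM I (\<lambda>_. M)) \<Longrightarrow> \<bar>\<Phi> S\<bar> \<le> B"
    and diff: "\<And>S i y. S \<in> space (PiM I (\<lambda>_. M)) \<Longrightarrow> i \<in> I \<Longrightarrow> y \<in> space M
      \<Longrightarrow> \<bar>\<Phi> (S(i := y)) - \<Phi> S\<bar> \<le> d"
  shows "(\<integral>S. exp (l * \<Phi> S) \<partial>PiM I (\<lambda>_. M))
    \<le> exp (l * (\<integral>S. \<Phi> S \<partial>PiM I (\<lambda>_. M)) + card I * (l\<^sup>2 * d\<^sup>2 / 8))"
  using I meas bnd diff
proof (induction I arbitrary: \<Phi> rule: finite_induct)
  case empty
  interpret product_sigma_finite "\<lambda>_::'i. M" by unfold_locales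
  show ?case by (simp add: PiM_empty lebesgue_integral_count_space_finite)
next
  case (insert i I)
  interpret product_sigma_finite "\<lambda>_::'i. M" by unfold_locales
  let ?P = "PiM I (\<lambda>_. M)" and ?Q = "PiM (insert i I) (\<lambda>_. M)"
  interpret PI: prob_space ?P by (intro prob_space_PiM prob_space_axioms)
  interpret QI: prob_space ?Q by (intro prob_space_PiM prob_space_axioms)
  note meas [measurable] = insert.prems(1)
  have upd: "S(i := y) \<in> space ?Q" if "S \<in> space ?P" "y \<in> space M" for S y
    using that by (auto simp: space_PiM PiE_def extensional_def)
  have pair [measurable]: "(\<lambda>(S, y). \<Phi> (S(i := y))) \<in> borel_measurable (?P \<Otimes>\<^sub>M M)"
  proof -
    have "(\<lambda>z. \<Phi> ((\<lambda>(S, y). S(i := y)) z)) \<in> borel_measurable (?P \<Otimes>\<^sub>M M)"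
      by measurable
    then show ?thesis by (simp add: case_prod_beta)
  qed
  have sec: "(\<lambda>y. \<Phi> (S(i := y))) \<in> borel_measurable M" if "S \<in> space ?P" for S
    using measurable_Pair2[OF pair that] by simp
  define \<Psi> where "\<Psi> = (\<lambda>S. \<integral>y. \<Phi> (S(i := y)) \<partial>M)"
  have \<Psi>_meas [measurable]: "\<Psi> \<in> borel_measurable ?P"
    unfolding \<Psi>_def by (rule borel_measurable_lebesgue_integral) (use pair in simp)
  have \<Psi>_bnd: "\<bar>\<Psi> S\<bar> \<le> B" if "S \<in> space ?P" for S
    unfolding \<Psi>_def using that by (intro abs_expectation_le sec insert.prems upd)
  have \<Psi>_diff: "\<bar>\<Psi> (S(j := z)) - \<Psi> S\<bar> \<le> d"
    if S: "S \<in> space ?P" and j: "j \<in> I" and z: "z \<in> space M" for S j z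
  proof -
    have S': "S(j := z) \<in> space ?P"
      using S j z by (auto simp: space_PiM PiE_def extensional_def)
    have int: "integrable M (\<lambda>y. \<Phi> (T(i := y)))" if "T \<in> space ?P" for T
      using that by (intro integrable_bounded[where B = B] sec insert.prems upd)
    have "\<Psi> (S(j := z)) - \<Psi> S = (\<integral>y. \<Phi> (S(j := z, i := y)) - \<Phi> (S(i := y)) \<partial>M)"
      unfolding \<Psi>_def using int[OF S] int[OF S'] by (subst Bochner_Integration.integral_diff) auto
    also have "\<bar>\<dots>\<bar> \<le> d"
    proof (rule abs_expectation_le)
      fix y assume y: "y \<in> space M"
      have eq: "S(j := z, i := y) = (S(i := y))(j := z)"
        using j insert.hyps by (auto simp: fun_upd_twist)
      show "\<bar>\<Phi> (S(j := z, i := y)) - \<Phi> (S(i := y))\<bar> \<le> d"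
        unfolding eq using j z by (intro insert.prems(3)[OF upd[OF S y]]) auto
    qed (use sec[OF S] sec[OF S'] in measurable)
    finally show ?thesis .
  qed
  have expB: "\<bar>exp (l * u)\<bar> \<le> exp (l * B)" if "\<bar>u\<bar> \<le> B" for u
    using that l by simp
  have int_exp: "integrable ?Q (\<lambda>S. exp (l * \<Phi> S))"
    by (rule QI.integrable_bounded[where B = "exp (l * B)"]) (measurable, intro expB insert.prems)
  have int\<Phi>: "integrable ?Q \<Phi>"
    by (rule QI.integrable_bounded[where B = B]) (use insert.prems in auto)
  have int_exp\<Psi>: "integrable ?P (\<lambda>S. exp (l * \<Psi> S))"
    by (rule PI.integrable_bounded[where B = "exp (l * B)"]) (measurable, intro expB \<Psi>_bnd)
  have int_inner: "integrable ?P (\<lambda>S. \<integral>y. exp (l * \<Phi> (S(i := y))) \<partial>M)"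
  proof (rule PI.integrable_bounded)
    show "(\<lambda>S. \<integral>y. exp (l * \<Phi> (S(i := y))) \<partial>M) \<in> borel_measurable ?P"
      by measurable
    fix S assume "S \<in> space ?P"
    then show "\<bar>\<integral>y. exp (l * \<Phi> (S(i := y))) \<partial>M\<bar> \<le> exp (l * B)"
      using sec[of S] by (intro abs_expectation_le expB insert.prems upd) measurable
  qed
  have "(\<integral>S. exp (l * \<Phi> S) \<partial>?Q) = (\<integral>S. (\<integral>y. exp (l * \<Phi> (S(i := y))) \<partial>M) \<partial>?P)"
    using insert.hyps int_exp by (rule product_integral_insert)
  also have "\<dots> \<le> (\<integral>S. exp (l\<^sup>2 * d\<^sup>2 / 8) * exp (l * \<Psi> S) \<partial>?P)"
  proof (rule integral_mono)
    fix S assume S: "S \<in> space ?P"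
    have "(\<integral>y. exp (l * \<Phi> (S(i := y))) \<partial>M) \<le> exp (l * \<Psi> S + l\<^sup>2 * d\<^sup>2 / 8)"
      unfolding \<Psi>_def
    proof (rule hoeffding_oscillation[OF sec[OF S] l])
      fix y y' assume y: "y \<in> space M" "y' \<in> space M"
      show "\<bar>\<Phi> (S(i := y)) - \<Phi> (S(i := y'))\<bar> \<le> d"
        using insert.prems(3)[OF upd[OF S y(2)], of i y] y(1) unfolding fun_upd_upd by blast
    qed
    then show "(\<integral>y. exp (l * \<Phi> (S(i := y))) \<partial>M) \<le> exp (l\<^sup>2 * d\<^sup>2 / 8) * exp (l * \<Psi> S)"
      by (simp add: exp_add mult.commute)
  qed (use int_inner int_exp\<Psi> in auto)
  also have "\<dots> = exp (l\<^sup>2 * d\<^sup>2 / 8) * (\<integral>S. exp (l * \<Psi> S) \<partial>?P)"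
    by simp
  also have "\<dots> \<le> exp (l\<^sup>2 * d\<^sup>2 / 8) * exp (l * (\<integral>S. \<Psi> S \<partial>?P) + card I * (l\<^sup>2 * d\<^sup>2 / 8))"
    by (intro mult_left_mono insert.IH \<Psi>_meas \<Psi>_bnd \<Psi>_diff) auto
  also have "(\<integral>S. \<Psi> S \<partial>?P) = (\<integral>S. \<Phi> S \<partial>?Q)"
    unfolding \<Psi>_def using insert.hyps int\<Phi> by (intro product_integral_insert[symmetric])
  finally show ?case
    using insert.hyps by (simp add: algebra_simps add_divide_distrib flip: exp_add)
qed

theorem (in prob_space) mcdiarmid:
  fixes \<Phi> :: "(nat \<Rightarrow> 'a) \<Rightarrow> real"
  assumes n: "n > 0" and d: "d > 0" and t: "t > 0"
    and meas: "\<Phi> \<in> borel_measurable (PiM {..<n} (\<lambda>_. M))"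
    and bnd: "\<And>S. S \<in> space (PiM {..<n} (\<lambda>_. M)) \<Longrightarrow> \<bar>\<Phi> S\<bar> \<le> B"
    and diff: "\<And>S i y. S \<in> space (PiM {..<n} (\<lambda>_. M)) \<Longrightarrow> i < n \<Longrightarrow> y \<in> space M
      \<Longrightarrow> \<bar>\<Phi> (S(i := y)) - \<Phi> S\<bar> \<le> d"
  shows "measure (PiM {..<n} (\<lambda>_. M))
      {S \<in> space (PiM {..<n} (\<lambda>_. M)). \<Phi> S \<ge> (\<integral>S. \<Phi> S \<partial>PiM {..<n} (\<lambda>_. M)) + t}
    \<le> exp (- 2 * t\<^sup>2 / (n * d\<^sup>2))"
proof -
  let ?P = "PiM {..<n} (\<lambda>_. M)"
  interpret PI: prob_space ?P by (intro prob_space_PiM prob_space_axioms)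
  note meas [measurable]
  define \<mu> where "\<mu> = (\<integral>S. \<Phi> S \<partial>?P)"
  \<comment> \<open>Minimizes the exponent
    \<open>n * (l\<^sup>2 * d\<^sup>2 / 8) - l * t\<close>.\<close>
  define l where "l = 4 * t / (n * d\<^sup>2)"
  have l: "l > 0" using n d t by (simp add: l_def)
  have "integrable ?P (\<lambda>S. exp (l * \<Phi> S))"
  proof (rule PI.integrable_bounded)
    fix S assume "S \<in> space ?P"
    then show "\<bar>exp (l * \<Phi> S)\<bar> \<le> exp (l * B)"
      using bnd[of S] l by simp
  qed measurable
  then have "set_integrable ?P (space ?P) (\<lambda>S. exp (l * \<Phi> S))"
    unfolding set_integrable_def by (rule integrable_mult_indicator[OF sets.top])
  then have "measure ?P {S \<in> space ?P. \<Phi> S \<ge> \<mu> + t}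
      \<le> exp (- l * (\<mu> + t)) * (\<integral>S\<in>space ?P. exp (l * \<Phi> S) \<partial>?P)"
    by (rule PI.Chernoff_ineq_ge[OF l]) simp
  also have "(\<integral>S\<in>space ?P. exp (l * \<Phi> S) \<partial>?P) = (\<integral>S. exp (l * \<Phi> S) \<partial>?P)"
    unfolding set_lebesgue_integral_def by (intro Bochner_Integration.integral_cong) auto
  also have "exp (- l * (\<mu> + t)) * \<dots> \<le> exp (- l * (\<mu> + t)) * exp (l * \<mu> + card {..<n} * (l\<^sup>2 * d\<^sup>2 / 8))"
    unfolding \<mu>_def using bnd diff by (intro mult_left_mono mgf_bounded_differences[OF _ l meas]) auto
  also have "\<dots> = exp (n * (l\<^sup>2 * d\<^sup>2 / 8) - l * t)"
    by (simp add: algebra_simps flip: exp_add)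
  also have "n * (l\<^sup>2 * d\<^sup>2 / 8) - l * t = - 2 * t\<^sup>2 / (n * d\<^sup>2)"
    using n d by (simp add: l_def field_simps power2_eq_square)
  finally show ?thesis by (simp add: \<mu>_def)
qed

section \<open>Symmetrization by a ghost sample\<close>

text \<open>Sample and ghost sample are the two halves of one product over
  \<open>{..<2 * n}\<close>, so that exchanging entries is a permutation of coordinates, under which
  the product measure is invariant. \<open>cong\<close> says that \<open>\<Psi>\<close> sees only
  the first \<open>n\<close> entries of each argument.\<close>

lemma (in prob_space) ghost_sample_swap:
  fixes \<Psi> :: "(nat \<Rightarrow> 'a) \<Rightarrow> (nat \<Rightarrow> 'a) \<Rightarrow> real"
  assumes \<epsilon>: "\<epsilon> \<in> signs n"
    and meas: "(\<lambda>\<omega>. \<Psi> (\<lambda>i. \<omega> i) (\<lambda>i. \<omega> (n + i))) \<in> borel_measurable (PiM {..<2 * n} (\<lambda>_. M))"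
    and cong: "\<And>S S' T T'. (\<And>i. i < n \<Longrightarrow> S i = T i) \<Longrightarrow> (\<And>i. i < n \<Longrightarrow> S' i = T' i) \<Longrightarrow> \<Psi> S S' = \<Psi> T T'"
  shows "(\<integral>\<omega>. \<Psi> (\<lambda>i. \<omega> i) (\<lambda>i. \<omega> (n + i)) \<partial>PiM {..<2 * n} (\<lambda>_. M))
    = (\<integral>\<omega>. \<Psi> (\<lambda>i. if \<epsilon> i = 1 then \<omega> i else \<omega> (n + i)) (\<lambda>i. if \<epsilon> i = 1 then \<omega> (n + i) else \<omega> i)
        \<partial>PiM {..<2 * n} (\<lambda>_. M))"
proof -
  let ?P = "PiM {..<2 * n} (\<lambda>_. M)"
  \<comment> \<open>Exchanges \<open>i\<close> and \<open>n + i\<close> where the sign is not 1.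
    Being the identity from \<open>2 * n\<close> on, it is an involution of all natural
    numbers.\<close>
  define f where "f = (\<lambda>j. if 2 * n \<le> j \<or> \<epsilon> (if j < n then j else j - n) = 1 then j
    else if j < n then n + j else j - n)"
  have ff: "f (f j) = j" for j
    by (auto simp: f_def)
  have f: "inj_on f {..<2 * n}" "f \<in> {..<2 * n} \<rightarrow> {..<2 * n}"
    by (intro inj_on_inverseI[of _ f] ff) (auto simp: f_def)
  have restr: "(\<lambda>\<omega>. \<lambda>j\<in>{..<2 * n}. \<omega> (f j)) \<in> measurable ?P ?P"
    using f(2) by (intro measurable_restrict measurable_component_singleton) auto
  have "distr ?P ?P (\<lambda>\<omega>. \<lambda>j\<in>{..<2 * n}. \<omega> (f j)) = ?P"
    using distr_PiM_reindex[OF _ f, of "\<lambda>_. M"] prob_space_axioms by simp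
  then have "(\<integral>\<omega>. \<Psi> (\<lambda>i. \<omega> i) (\<lambda>i. \<omega> (n + i)) \<partial>?P)
      = (\<integral>\<omega>. \<Psi> (\<lambda>i. \<omega> i) (\<lambda>i. \<omega> (n + i)) \<partial>distr ?P ?P (\<lambda>\<omega>. \<lambda>j\<in>{..<2 * n}. \<omega> (f j)))"
    by simp
  also have "\<dots> = (\<integral>\<omega>. \<Psi> (\<lambda>i. (\<lambda>j\<in>{..<2 * n}. \<omega> (f j)) i) (\<lambda>i. (\<lambda>j\<in>{..<2 * n}. \<omega> (f j)) (n + i)) \<partial>?P)"
    by (rule integral_distr[OF restr meas])
  also have "\<dots> = (\<integral>\<omega>. \<Psi> (\<lambda>i. if \<epsilon> i = 1 then \<omega> i else \<omega> (n + i)) (\<lambda>i. if \<epsilon> i = 1 then \<omega> (n + i) else \<omega> i) \<partial>?P)"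
    by (intro Bochner_Integration.integral_cong refl cong) (auto simp: f_def)
  finally show ?thesis .
qed

lemma (in prob_space) symmetrization:
  fixes H :: "('a \<Rightarrow> real) set"
  assumes H: "finite H" "H \<noteq> {}" and meas: "\<And>h. h \<in> H \<Longrightarrow> h \<in> borel_measurable M"
    and rng: "\<And>h z. h \<in> H \<Longrightarrow> z \<in> space M \<Longrightarrow> \<bar>h z\<bar> \<le> 1"
    and rad: "\<And>S. (\<And>i. i < n \<Longrightarrow> S i \<in> space M)
      \<Longrightarrow> sign_avg n (\<lambda>\<epsilon>. MAX h\<in>H. pairing n \<epsilon> (\<lambda>i. h (S i))) \<le> K"
  shows "(\<integral>S. (MAX h\<in>H. n * expectation h - (\<Sum>i<n. h (S i))) \<partial>PiM {..<n} (\<lambda>_. M)) \<le> 2 * K"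
proof -
  let ?I = "{..<n}" and ?J = "{n..<2 * n}"
  let ?P = "PiM ?I (\<lambda>_. M)" and ?P' = "PiM ?J (\<lambda>_. M)" and ?Q = "PiM {..<2 * n} (\<lambda>_. M)"
  interpret product_sigma_finite "\<lambda>_::nat. M" by unfold_locales
  interpret PI: prob_space ?P by (intro prob_space_PiM prob_space_axioms)
  interpret PJ: prob_space ?P' by (intro prob_space_PiM prob_space_axioms)
  interpret QI: prob_space ?Q by (intro prob_space_PiM prob_space_axioms)
  have IJ: "?I \<union> ?J = {..<2 * n}" "?I \<inter> ?J = {}" by auto
  have comp: "(\<lambda>\<omega>. h (\<omega> j)) \<in> borel_measurable (PiM L (\<lambda>_. M))" if "h \<in> H" "j \<in> L" for h j and L :: "nat set"
    using measurable_compose[OF measurable_component_singleton[OF that(2)] meas[OF that(1)]] by simp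
  have inM: "\<omega> j \<in> space M" if "\<omega> \<in> space (PiM L (\<lambda>_. M))" "j \<in> L" for \<omega> j and L :: "nat set"
    using that by (auto simp: space_PiM)
  have sumbnd: "\<bar>\<Sum>i<n. u i\<bar> \<le> n * b" if "\<And>i. i < n \<Longrightarrow> \<bar>u i\<bar> \<le> b" for u :: "nat \<Rightarrow> real" and b :: real
    using that sum_mono[of "{..<n}" "\<lambda>i. \<bar>u i\<bar>" "\<lambda>_. b"] order_trans[OF sum_abs] by fastforce
  define \<Psi> where "\<Psi> = (\<lambda>S S'. MAX h\<in>H. \<Sum>i<n. h (S' i) - h (S i))"
  define \<Theta> where "\<Theta> = (\<lambda>\<epsilon> \<omega>. MAX h\<in>H. pairing n \<epsilon> (\<lambda>i. h (\<omega> (n + i)) - h (\<omega> i)))"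
  have diff2: "\<bar>h z' - h z\<bar> \<le> 2" if "h \<in> H" "z \<in> space M" "z' \<in> space M" for h z z'
    using rng[OF that(1,2)] rng[OF that(1,3)] by linarith
  have \<Theta>_meas: "\<Theta> \<epsilon> \<in> borel_measurable ?Q" for \<epsilon>
    unfolding \<Theta>_def pairing_def
    by (intro borel_measurable_Max H borel_measurable_sum borel_measurable_times[OF borel_measurable_const]
        borel_measurable_diff comp) auto
  have \<Theta>_bnd: "\<bar>\<Theta> \<epsilon> \<omega>\<bar> \<le> real n * 2" if "\<epsilon> \<in> signs n" "\<omega> \<in> space ?Q" for \<epsilon> \<omega>
    unfolding \<Theta>_def pairing_def
    using that by (intro abs_Max_le H sumbnd) (auto simp: abs_mult abs_signs intro!: diff2 inM[OF that(2)])
  have \<Theta>_int: "integrable ?Q (\<Theta> \<epsilon>)" if "\<epsilon> \<in> signs n" for \<epsilon>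
    using that by (intro QI.integrable_bounded[where B = "real n * 2"] \<Theta>_meas \<Theta>_bnd)
  have \<Psi>_meas: "(\<lambda>\<omega>. \<Psi> (\<lambda>i. \<omega> i) (\<lambda>i. \<omega> (n + i))) \<in> borel_measurable ?Q"
    unfolding \<Psi>_def
    by (intro borel_measurable_Max H borel_measurable_sum borel_measurable_diff comp) auto
  have \<Psi>_bnd: "\<bar>\<Psi> S S'\<bar> \<le> real n * 2" if "\<And>i. i < n \<Longrightarrow> S i \<in> space M" "\<And>i. i < n \<Longrightarrow> S' i \<in> space M" for S S'
    unfolding \<Psi>_def using that by (intro abs_Max_le H sumbnd diff2) auto
  have \<Psi>_int: "integrable ?Q (\<lambda>\<omega>. \<Psi> (\<lambda>i. \<omega> i) (\<lambda>i. \<omega> (n + i)))"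
    by (intro QI.integrable_bounded[where B = "real n * 2"] \<Psi>_meas \<Psi>_bnd) (auto intro: inM)

  have swap: "(\<integral>\<omega>. \<Psi> (\<lambda>i. \<omega> i) (\<lambda>i. \<omega> (n + i)) \<partial>?Q) = (\<integral>\<omega>. \<Theta> \<epsilon> \<omega> \<partial>?Q)" if \<epsilon>: "\<epsilon> \<in> signs n" for \<epsilon>
  proof -
    have "(\<integral>\<omega>. \<Psi> (\<lambda>i. \<omega> i) (\<lambda>i. \<omega> (n + i)) \<partial>?Q)
        = (\<integral>\<omega>. \<Psi> (\<lambda>i. if \<epsilon> i = 1 then \<omega> i else \<omega> (n + i)) (\<lambda>i. if \<epsilon> i = 1 then \<omega> (n + i) else \<omega> i) \<partial>?Q)"
      by (rule ghost_sample_swap[where \<Psi> = \<Psi>, OF \<epsilon> \<Psi>_meas]) (simp add: \<Psi>_def)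
    also have "\<dots> = (\<integral>\<omega>. \<Theta> \<epsilon> \<omega> \<partial>?Q)"
    proof (intro Bochner_Integration.integral_cong refl)
      fix \<omega> :: "nat \<Rightarrow> 'a"
      have "(\<Sum>i<n. h (if \<epsilon> i = 1 then \<omega> (n + i) else \<omega> i) - h (if \<epsilon> i = 1 then \<omega> i else \<omega> (n + i)))
          = pairing n \<epsilon> (\<lambda>i. h (\<omega> (n + i)) - h (\<omega> i))" for h
        unfolding pairing_def using signs_cases[OF \<epsilon>] by (intro sum.cong) fastforce+
      then show "\<Psi> (\<lambda>i. if \<epsilon> i = 1 then \<omega> i else \<omega> (n + i)) (\<lambda>i. if \<epsilon> i = 1 then \<omega> (n + i) else \<omega> i) = \<Theta> \<epsilon> \<omega>"
        by (simp add: \<Psi>_def \<Theta>_def)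
    qed
    finally show ?thesis .
  qed
  \<comment> \<open>By subadditivity of the maximum each half of the double sample is treated alone,
    and \<open>rad\<close> applies to it as a fixed sample; this yields the factor 2 in the
    result.\<close>
  have split: "sign_avg n (\<lambda>\<epsilon>. \<Theta> \<epsilon> \<omega>) \<le> 2 * K" if \<omega>: "\<omega> \<in> space ?Q" for \<omega>
  proof -
    have "sign_avg n (\<lambda>\<epsilon>. \<Theta> \<epsilon> \<omega>) \<le> sign_avg n (\<lambda>\<epsilon>. (MAX h\<in>H. pairing n \<epsilon> (\<lambda>i. h (\<omega> (n + i))))
        + (MAX h\<in>H. - pairing n \<epsilon> (\<lambda>i. h (\<omega> i))))"
    proof (rule sign_avg_mono)
      fix \<epsilon>
      have "pairing n \<epsilon> (\<lambda>i. h (\<omega> (n + i)) - h (\<omega> i))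
          \<le> (MAX h\<in>H. pairing n \<epsilon> (\<lambda>i. h (\<omega> (n + i)))) + (MAX h\<in>H. - pairing n \<epsilon> (\<lambda>i. h (\<omega> i)))"
        if "h \<in> H" for h
      proof -
        have "pairing n \<epsilon> (\<lambda>i. h (\<omega> (n + i)) - h (\<omega> i))
            = pairing n \<epsilon> (\<lambda>i. h (\<omega> (n + i))) + (- pairing n \<epsilon> (\<lambda>i. h (\<omega> i)))"
          by (simp add: pairing_def right_diff_distrib sum_subtractf)
        also have "\<dots> \<le> (MAX h\<in>H. pairing n \<epsilon> (\<lambda>i. h (\<omega> (n + i)))) + (MAX h\<in>H. - pairing n \<epsilon> (\<lambda>i. h (\<omega> i)))"
          using that H by (intro add_mono Max_ge) auto
        finally show ?thesis .
      qed
      then show "\<Theta> \<epsilon> \<omega> \<le> (MAX h\<in>H. pairing n \<epsilon> (\<lambda>i. h (\<omega> (n + i))))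
        + (MAX h\<in>H. - pairing n \<epsilon> (\<lambda>i. h (\<omega> i)))"
        unfolding \<Theta>_def using H by (intro Max.boundedI) auto
    qed
    also have "\<dots> = sign_avg n (\<lambda>\<epsilon>. MAX h\<in>H. pairing n \<epsilon> (\<lambda>i. h (\<omega> (n + i))))
        + sign_avg n (\<lambda>\<epsilon>. MAX h\<in>H. pairing n \<epsilon> (\<lambda>i. h (\<omega> i)))"
      unfolding sign_avg_add
      using sign_avg_pairing_uminus[of n "\<lambda>p. MAX h\<in>H. p (\<lambda>i. h (\<omega> i))"] by simp
    also have "\<dots> \<le> K + K"
      by (intro add_mono rad inM[OF \<omega>]) auto
    finally show ?thesis by simp
  qed
  have "(\<integral>\<omega>. \<Psi> (\<lambda>i. \<omega> i) (\<lambda>i. \<omega> (n + i)) \<partial>?Q)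
      = sign_avg n (\<lambda>_. \<integral>\<omega>. \<Psi> (\<lambda>i. \<omega> i) (\<lambda>i. \<omega> (n + i)) \<partial>?Q)"
    by (rule sign_avg_const[symmetric])
  also have "\<dots> = sign_avg n (\<lambda>\<epsilon>. \<integral>\<omega>. \<Theta> \<epsilon> \<omega> \<partial>?Q)"
    by (rule sign_avg_cong) (rule swap)
  also have "\<dots> = (\<integral>\<omega>. sign_avg n (\<lambda>\<epsilon>. \<Theta> \<epsilon> \<omega>) \<partial>?Q)"
    unfolding sign_avg_def using \<Theta>_int by (simp add: Bochner_Integration.integral_sum)
  also have "\<dots> \<le> 2 * K"
    using \<Theta>_int split by (intro QI.integral_le_const) (auto simp: sign_avg_def)
  finally have ub: "(\<integral>\<omega>. \<Psi> (\<lambda>i. \<omega> i) (\<lambda>i. \<omega> (n + i)) \<partial>?Q) \<le> 2 * K" .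

  \<comment> \<open>Same quantity, but the ghost sample keeps its indices
    \<open>{n..<2 * n}\<close>, as Fubini on the two disjoint index blocks requires.\<close>
  define \<Psi>' where "\<Psi>' = (\<lambda>S S'. MAX h\<in>H. \<Sum>i<n. h (S' (n + i)) - h (S i))"
  have \<Psi>'_meas: "(\<lambda>S'. \<Psi>' S S') \<in> borel_measurable ?P'" for S
    unfolding \<Psi>'_def
    by (intro borel_measurable_Max H borel_measurable_sum 
        borel_measurable_diff[OF comp borel_measurable_const]) auto
  have \<Psi>'_bnd: "\<bar>\<Psi>' S S'\<bar> \<le> real n * 2" if "S \<in> space ?P" "S' \<in> space ?P'" for S S'
    using \<Psi>_bnd[of S "\<lambda>i. S' (n + i)"] inM[OF that(1)] inM[OF that(2)] by (simp add: \<Psi>_def \<Psi>'_def)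
  have fold: "(\<integral>\<omega>. \<Psi> (\<lambda>i. \<omega> i) (\<lambda>i. \<omega> (n + i)) \<partial>?Q) = (\<integral>S. (\<integral>S'. \<Psi>' S S' \<partial>?P') \<partial>?P)"
  proof -
    have "(\<integral>\<omega>. \<Psi> (\<lambda>i. \<omega> i) (\<lambda>i. \<omega> (n + i)) \<partial>?Q)
        = (\<integral>S. (\<integral>S'. \<Psi> (\<lambda>i. merge ?I ?J (S, S') i) (\<lambda>i. merge ?I ?J (S, S') (n + i)) \<partial>?P') \<partial>?P)"
      using product_integral_fold[OF IJ(2), of "\<lambda>\<omega>. \<Psi> (\<lambda>i. \<omega> i) (\<lambda>i. \<omega> (n + i))"] \<Psi>_int IJ(1) by simp
    also have "(\<lambda>S S'. \<Psi> (\<lambda>i. merge ?I ?J (S, S') i) (\<lambda>i. merge ?I ?J (S, S') (n + i))) = \<Psi>'"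
    proof (intro ext)
      fix S S' :: "nat \<Rightarrow> 'a"
      have "(\<Sum>i<n. h (merge ?I ?J (S, S') (n + i)) - h (merge ?I ?J (S, S') i))
          = (\<Sum>i<n. h (S' (n + i)) - h (S i))" for h :: "'a \<Rightarrow> real"
        by (intro sum.cong) (auto simp: merge_def)
      then show "\<Psi> (\<lambda>i. merge ?I ?J (S, S') i) (\<lambda>i. merge ?I ?J (S, S') (n + i)) = \<Psi>' S S'"
        by (simp add: \<Psi>_def \<Psi>'_def)
    qed
    finally show ?thesis .
  qed
  \<comment> \<open>Jensen's inequality for the maximum: averaging over the ghost sample turns each
    \<open>h (S' (n + i))\<close> into its expectation.\<close>
  have inner: "(MAX h\<in>H. n * expectation h - (\<Sum>i<n. h (S i))) \<le> (\<integral>S'. \<Psi>' S S' \<partial>?P')" if S: "S \<in> space ?P" for S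
  proof (rule Max.boundedI)
    fix y assume "y \<in> (\<lambda>h. n * expectation h - (\<Sum>i<n. h (S i))) ` H"
    then obtain h where h: "h \<in> H" and y: "y = n * expectation h - (\<Sum>i<n. h (S i))" by auto
    have int: "integrable ?P' (\<lambda>S'. h (S' (n + i)))" if "i < n" for i
      using that h by (intro PJ.integrable_bounded[where B = 1] comp rng inM) auto
    have E: "(\<integral>S'. h (S' (n + i)) \<partial>?P') = expectation h" if "i < n" for i
    proof -
      have "expectation h = (\<integral>z. h z \<partial>distr ?P' M (\<lambda>\<omega>. \<omega> (n + i)))"
        using distr_PiM_component[of ?J "\<lambda>_. M" "n + i"] that prob_space_axioms by simp
      also have "\<dots> = (\<integral>S'. h (S' (n + i)) \<partial>?P')"
        using that h meas by (intro integral_distr measurable_component_singleton) auto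
      finally show ?thesis by simp
    qed
    have "y = (\<integral>S'. (\<Sum>i<n. h (S' (n + i)) - h (S i)) \<partial>?P')"
      using int E by (subst Bochner_Integration.integral_sum) (auto simp: y PJ.prob_space sum_subtractf)
    also have "\<dots> \<le> (\<integral>S'. \<Psi>' S S' \<partial>?P')"
    proof (rule integral_mono)
      show "integrable ?P' (\<lambda>S'. \<Psi>' S S')"
        using S by (intro PJ.integrable_bounded[where B = "real n * 2"] \<Psi>'_meas \<Psi>'_bnd)
    qed (use int h H in \<open>auto simp: \<Psi>'_def intro!: Max_ge\<close>)
    finally show "y \<le> (\<integral>S'. \<Psi>' S S' \<partial>?P')" .
  qed (use H in auto)
  have "(\<integral>S. (MAX h\<in>H. n * expectation h - (\<Sum>i<n. h (S i))) \<partial>?P) \<le> (\<integral>S. (\<integral>S'. \<Psi>' S S' \<partial>?P') \<partial>?P)"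
  proof (rule integral_mono)
    show "integrable ?P (\<lambda>S. MAX h\<in>H. n * expectation h - (\<Sum>i<n. h (S i)))"
    proof (rule PI.integrable_bounded)
      fix S assume S: "S \<in> space ?P"
      show "\<bar>MAX h\<in>H. n * expectation h - (\<Sum>i<n. h (S i))\<bar> \<le> real n * 2"
      proof (rule abs_Max_le[OF H])
        fix h assume h: "h \<in> H"
        have "\<bar>real n * expectation h\<bar> \<le> real n * 1"
          unfolding abs_mult using h by (intro mult_mono abs_expectation_le meas rng) auto
        moreover have "\<bar>\<Sum>i<n. h (S i)\<bar> \<le> real n * 1"
          using h by (intro sumbnd rng inM[OF S]) auto
        ultimately show "\<bar>real n * expectation h - (\<Sum>i<n. h (S i))\<bar> \<le> real n * 2" by linarith
      qed
    qed (intro borel_measurable_Max H borel_measurable_diff borel_measurable_const borel_measurable_sum comp, auto)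
    show "integrable ?P (\<lambda>S. \<integral>S'. \<Psi>' S S' \<partial>?P')"
    proof (rule PI.integrable_bounded)
      have "(\<lambda>(S, S'). \<Psi>' S S') \<in> borel_measurable (?P \<Otimes>\<^sub>M ?P')"
        unfolding \<Psi>'_def case_prod_beta
        by (intro borel_measurable_Max H borel_measurable_sum borel_measurable_diff
            measurable_compose[OF measurable_fst comp] measurable_compose[OF measurable_snd comp]) auto
      then show "(\<lambda>S. \<integral>S'. \<Psi>' S S' \<partial>?P') \<in> borel_measurable ?P"
        by (rule PJ.borel_measurable_lebesgue_integral)
      show "\<bar>\<integral>S'. \<Psi>' S S' \<partial>?P'\<bar> \<le> real n * 2" if "S \<in> space ?P" for S
        using that by (intro PJ.abs_expectation_le \<Psi>'_meas \<Psi>'_bnd)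
    qed
  qed (rule inner)
  then show ?thesis using fold ub by simp
qed

section \<open>Generalization bounds\<close>

lemma sign_avg_pairing: "sign_avg n (\<lambda>\<epsilon>. pairing n \<epsilon> a) = 0"
  using sign_avg_pairing_uminus[of n "\<lambda>p. p a"] sign_avg_cmult[of n "-1" "\<lambda>\<epsilon>. pairing n \<epsilon> a"] by simp

text \<open>The losses \<open>\<phi> i\<close> need not vanish at 0, as contraction demands.
  Subtracting \<open>\<phi> i 0\<close> shifts all members of the class by the same signed sum,
  whose average is 0.\<close>

lemma sign_avg_Max_lipschitz_le:
  fixes t :: "'f \<Rightarrow> nat \<Rightarrow> real" and \<phi> :: "nat \<Rightarrow> real \<Rightarrow> real"
  assumes F: "finite F" "F \<noteq> {}"
    and lip: "\<And>i u v. i < n \<Longrightarrow> \<bar>\<phi> i u - \<phi> i v\<bar> \<le> \<bar>u - v\<bar>"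
  shows "sign_avg n (\<lambda>\<epsilon>. MAX f\<in>F. pairing n \<epsilon> (\<lambda>i. \<phi> i (t f i)))
    \<le> sign_avg n (\<lambda>\<epsilon>. MAX f\<in>F. pairing n \<epsilon> (t f))"
proof -
  define \<phi>' where "\<phi>' = (\<lambda>i u. \<phi> i u - \<phi> i 0)"
  have "pairing n \<epsilon> (\<lambda>i. \<phi> i (t f i)) = pairing n \<epsilon> (\<lambda>i. \<phi>' i (t f i)) + pairing n \<epsilon> (\<lambda>i. \<phi> i 0)" for \<epsilon> f
    by (simp add: pairing_def \<phi>'_def algebra_simps flip: sum.distrib)
  then have "sign_avg n (\<lambda>\<epsilon>. MAX f\<in>F. pairing n \<epsilon> (\<lambda>i. \<phi> i (t f i)))
      = sign_avg n (\<lambda>\<epsilon>. MAX f\<in>F. pairing n \<epsilon> (\<lambda>i. \<phi>' i (t f i)))"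
    using F by (simp add: Max_add_commute sign_avg_add sign_avg_pairing)
  also have "\<dots> \<le> sign_avg n (\<lambda>\<epsilon>. MAX f\<in>F. pairing n \<epsilon> (t f))"
    using contraction_principle[OF F, where G = "\<lambda>x. x" and \<phi> = \<phi>' and t = t and n = n] lip
    by (simp add: convex_on_ident \<phi>'_def mono_def)
  finally show ?thesis .
qed

context finite_relu_class
begin

lemma sign_avg_scaled_output_le:
  assumes \<tau>: "\<tau> > 0"
    and bound: "\<tau> + ((\<Sum>i\<le>k. 2 ^ i * gauss_tail \<tau> (c ^ i)) + 2 ^ k * real (ds ! 0) * gauss_tail \<tau> (c ^ k)) \<le> B"
  shows "sign_avg n (\<lambda>\<epsilon>. MAX W\<in>P. pairing n \<epsilon> (\<lambda>i. pre_act W ds k (x i) 0)) \<le> sqrt n * co * B"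
proof -
  define \<theta> where "\<theta> = sqrt n * co * \<tau>"
  have pos: "sqrt n * co > 0" using n co by simp
  have \<theta>: "\<theta> > 0" using pos \<tau> by (simp add: \<theta>_def)
  have ex: "excess \<theta> n (co * c ^ i) = sqrt n * co * gauss_tail \<tau> (c ^ i)" for i
    unfolding \<theta>_def using n co \<tau> c by (intro excess_scale) auto
  have "sign_avg n (\<lambda>\<epsilon>. MAX W\<in>P. pairing n \<epsilon> (\<lambda>i. pre_act W ds k (x i) 0))
      \<le> \<theta> + ((\<Sum>i\<le>k. 2 ^ i * excess \<theta> n (co * c ^ i)) + 2 ^ k * real (ds ! 0) * excess \<theta> n (co * c ^ k))"
    by (rule sign_avg_output_le[OF \<theta>])
  also have "\<dots> = sqrt n * co * (\<tau> + ((\<Sum>i\<le>k. 2 ^ i * gauss_tail \<tau> (c ^ i))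
      + 2 ^ k * real (ds ! 0) * gauss_tail \<tau> (c ^ k)))"
    unfolding ex by (simp add: \<theta>_def sum_distrib_left distrib_left mult_ac)
  also have "\<dots> \<le> sqrt n * co * B"
    using bound pos by (intro mult_left_mono) auto
  finally show ?thesis .
qed

theorem rademacher_bound:
  "sign_avg n (\<lambda>\<epsilon>. MAX W\<in>P. pairing n \<epsilon> (\<lambda>i. pre_act W ds k (x i) 0))
    \<le> sqrt n * co * min (2 * max 1 (c ^ k) * sqrt (real k + 2 + ln (real (ds ! 0) + 1)))
        (sqrt ((real k + 1) * ln 16) * (\<Sum>i\<le>k. c ^ i)
          + c ^ k * (sqrt (2 * ln (2 * real (ds ! 0))) + sqrt ((real k + 1) * ln 16)))"
proof -
  have m: "ds ! 0 \<ge> 1" using width[of 0] by simp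
  show ?thesis
    using sign_avg_scaled_output_le[OF peeled_bound_uniform[OF c m]]
      sign_avg_scaled_output_le[OF peeled_bound_layerwise[OF c m]]
    by (auto simp: min_def)
qed

end

section \<open>Finite and countable classes\<close>

theorem (in prob_space) finite_class_generalization:
  fixes H :: "('a \<Rightarrow> real) set" and n :: nat
  assumes H: "finite H" "H \<noteq> {}" and meas: "\<And>h. h \<in> H \<Longrightarrow> h \<in> borel_measurable M"
    and rng: "\<And>h z. h \<in> H \<Longrightarrow> z \<in> space M \<Longrightarrow> h z \<in> {0..1}"
    and rad: "\<And>S. (\<And>i. i < n \<Longrightarrow> S i \<in> space M)
      \<Longrightarrow> sign_avg n (\<lambda>\<epsilon>. MAX h\<in>H. pairing n \<epsilon> (\<lambda>i. h (S i))) \<le> K"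
    and n: "n > 0" and \<delta>: "0 < \<delta>" "\<delta> < 1"
  shows "measure (PiM {..<n} (\<lambda>_. M)) {S \<in> space (PiM {..<n} (\<lambda>_. M)). \<forall>h\<in>H.
      expectation h \<le> (1 / n) * (\<Sum>i<n. h (S i)) + sqrt (ln (1 / \<delta>) / (2 * real n)) + 2 * K / n} \<ge> 1 - \<delta>"
    (is "measure ?P ?A \<ge> _")
proof -
  interpret PI: prob_space ?P by (intro prob_space_PiM prob_space_axioms)
  have comp: "(\<lambda>S. h (S i)) \<in> borel_measurable ?P" if "h \<in> H" "i < n" for h i
    by (rule measurable_PiM_component_rev) (use that meas in auto)
  have inM: "S i \<in> space M" if "S \<in> space ?P" "i < n" for S i
    using that by (auto simp: space_PiM)
  have abs1: "\<bar>h z\<bar> \<le> 1" if "h \<in> H" "z \<in> space M" for h z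
    using rng[OF that] by auto
  define \<Phi> where "\<Phi> = (\<lambda>S. MAX h\<in>H. n * expectation h - (\<Sum>i<n. h (S i)))"
  \<comment> \<open>Solves \<open>exp (- 2 * t\<^sup>2 / n) = \<delta>\<close>. The deviation is not
    divided by \<open>n\<close>, so changing one sample point moves it by at most 1.\<close>
  define t where "t = n * sqrt (ln (1 / \<delta>) / (2 * real n))"
  have t: "t > 0" using n \<delta> by (simp add: t_def)
  have \<Phi>_meas: "\<Phi> \<in> borel_measurable ?P"
    unfolding \<Phi>_def
    by (intro borel_measurable_Max H borel_measurable_diff borel_measurable_const borel_measurable_sum comp) auto
  have \<Phi>_bnd: "\<bar>\<Phi> S\<bar> \<le> real n" if S: "S \<in> space ?P" for S
    unfolding \<Phi>_def
  proof (rule abs_Max_le[OF H])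
    fix h assume h: "h \<in> H"
    have int: "integrable M h"
      using h by (intro integrable_bounded[where B = 1] meas abs1)
    have "expectation h \<le> 1" "0 \<le> expectation h"
      using rng[OF h] by (auto intro!: integral_le_const int integral_nonneg)
    then have "real n * expectation h \<le> real n * 1" "0 \<le> real n * expectation h"
      by (auto intro!: mult_left_mono simp del: mult_1_right)
    moreover have "(\<Sum>i<n. h (S i)) \<le> (\<Sum>i<n. 1)" "0 \<le> (\<Sum>i<n. h (S i))"
      using rng[OF h inM[OF S]] by (intro sum_mono sum_nonneg; simp)+
    ultimately show "\<bar>real n * expectation h - (\<Sum>i<n. h (S i))\<bar> \<le> real n" by simp
  qed
  have \<Phi>_diff: "\<bar>\<Phi> (S(i := y)) - \<Phi> S\<bar> \<le> 1" if S: "S \<in> space ?P" and i: "i < n" and y: "y \<in> space M" for S i y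
  proof -
    have d: "\<bar>(\<Sum>j<n. h ((S(i := y)) j)) - (\<Sum>j<n. h (S j))\<bar> \<le> 1" if h: "h \<in> H" for h
    proof -
      have "(\<Sum>j<n. h ((S(i := y)) j)) - (\<Sum>j<n. h (S j)) = h y - h (S i)"
        using i by (simp add: sum.remove[of "{..<n}" i])
      then show ?thesis
        using rng[OF h y] rng[OF h inM[OF S i]] by auto
    qed
    have "\<Phi> (S(i := y)) \<le> \<Phi> S + 1" "\<Phi> S \<le> \<Phi> (S(i := y)) + 1"
      unfolding \<Phi>_def using d by (intro Max_le_Max_add H; fastforce)+
    then show ?thesis by linarith
  qed
  have E: "(\<integral>S. \<Phi> S \<partial>?P) \<le> 2 * K"
    unfolding \<Phi>_def by (intro symmetrization H meas rad abs1)
  define Bad where "Bad = {S \<in> space ?P. \<Phi> S \<ge> (\<integral>S. \<Phi> S \<partial>?P) + t}"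
  have Bad: "Bad \<in> sets ?P"
    unfolding Bad_def using \<Phi>_meas by measurable
  have "measure ?P Bad \<le> exp (- 2 * t\<^sup>2 / (real n * 1\<^sup>2))"
    unfolding Bad_def by (rule mcdiarmid[OF n _ t \<Phi>_meas \<Phi>_bnd \<Phi>_diff]) auto
  also have "- 2 * t\<^sup>2 / (real n * 1\<^sup>2) = - ln (1 / \<delta>)"
  proof -
    have "t\<^sup>2 = n\<^sup>2 * (ln (1 / \<delta>) / (2 * real n))"
      unfolding t_def power_mult_distrib using \<delta> by (subst real_sqrt_pow2) auto
    then show ?thesis using n by (simp add: power2_eq_square field_simps)
  qed
  also have "exp (- ln (1 / \<delta>)) = inverse (exp (ln (1 / \<delta>)))"
    by (rule exp_minus)
  also have "\<dots> = \<delta>"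
    using \<delta> by (subst exp_ln) auto
  finally have "measure ?P Bad \<le> \<delta>" .
  then have "1 - \<delta> \<le> measure ?P (space ?P - Bad)"
    using PI.prob_compl[OF Bad] by simp
  also have "\<dots> \<le> measure ?P ?A"
  proof (rule PI.finite_measure_mono)
    show "?A \<in> sets ?P"
      using H comp by measurable
    show "space ?P - Bad \<subseteq> ?A"
    proof (intro subsetI CollectI conjI ballI)
      fix S h assume S: "S \<in> space ?P - Bad" and h: "h \<in> H"
      have "n * expectation h - (\<Sum>i<n. h (S i)) \<le> \<Phi> S"
        unfolding \<Phi>_def using H h by (intro Max_ge) auto
      also have "\<Phi> S \<le> 2 * K + t"
        using S E by (auto simp: Bad_def)
      finally have "n * expectation h \<le> (\<Sum>i<n. h (S i)) + t + 2 * K" by simp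
      then have "expectation h \<le> ((\<Sum>i<n. h (S i)) + t + 2 * K) / n"
        using n by (simp add: field_simps)
      also have "\<dots> = (1 / n) * (\<Sum>i<n. h (S i)) + sqrt (ln (1 / \<delta>) / (2 * real n)) + 2 * K / n"
        using n by (simp add: t_def add_divide_distrib)
      finally show "expectation h \<le> (1 / n) * (\<Sum>i<n. h (S i)) + sqrt (ln (1 / \<delta>) / (2 * real n)) + 2 * K / n" .
    qed auto
  qed
  finally show ?thesis .
qed

text \<open>\<open>K\<close> is the same for all finite subclasses, so no confidence is lost: the
  good events of an increasing exhaustion decrease to \<open>A\<close>, and continuity from above
  preserves the bound \<open>1 - \<delta>\<close>.\<close>

theorem (in prob_space) countable_class_generalization:
  fixes H :: "('a \<Rightarrow> real) set" and n :: nat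
  assumes H: "countable H" and meas: "\<And>h. h \<in> H \<Longrightarrow> h \<in> borel_measurable M"
    and rng: "\<And>h z. h \<in> H \<Longrightarrow> z \<in> space M \<Longrightarrow> h z \<in> {0..1}"
    and rad: "\<And>F S. finite F \<Longrightarrow> F \<noteq> {} \<Longrightarrow> F \<subseteq> H \<Longrightarrow> (\<And>i. i < n \<Longrightarrow> S i \<in> space M)
      \<Longrightarrow> sign_avg n (\<lambda>\<epsilon>. MAX h\<in>F. pairing n \<epsilon> (\<lambda>i. h (S i))) \<le> K"
    and n: "n > 0" and \<delta>: "0 < \<delta>" "\<delta> < 1"
  defines "A \<equiv> {S \<in> space (PiM {..<n} (\<lambda>_. M)). \<forall>h\<in>H.
      expectation h \<le> (1 / n) * (\<Sum>i<n. h (S i)) + sqrt (ln (1 / \<delta>) / (2 * real n)) + 2 * K / n}"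
  shows "A \<in> sets (PiM {..<n} (\<lambda>_. M))" and "measure (PiM {..<n} (\<lambda>_. M)) A \<ge> 1 - \<delta>"
proof -
  let ?P = "PiM {..<n} (\<lambda>_. M)"
  interpret PI: prob_space ?P by (intro prob_space_PiM prob_space_axioms)
  have comp: "(\<lambda>S. h (S i)) \<in> borel_measurable ?P" if "h \<in> H" "i < n" for h i
    by (rule measurable_PiM_component_rev) (use that meas in auto)
  define B where "B = (\<lambda>F. {S \<in> space ?P. \<forall>h\<in>F.
      expectation h \<le> (1 / n) * (\<Sum>i<n. h (S i)) + sqrt (ln (1 / \<delta>) / (2 * real n)) + 2 * K / n})"
  have B_sets: "B F \<in> sets ?P" if F: "finite F" "F \<subseteq> H" for F
  proof -
    have [measurable]: "(\<lambda>S. \<Sum>i<n. h (S i)) \<in> borel_measurable ?P" if "h \<in> F" for h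
      using that F by (intro borel_measurable_sum comp) auto
    show ?thesis
      unfolding B_def using F(1) by measurable
  qed
  have "A \<in> sets ?P \<and> measure ?P A \<ge> 1 - \<delta>"
  proof (cases "H = {}")
    case True
    then show ?thesis using PI.prob_space \<delta> by (simp add: A_def)
  next
    case False
    define F where "F = (\<lambda>N. from_nat_into H ` {..N::nat})"
    have F: "finite (F N)" "F N \<noteq> {}" "F N \<subseteq> H" for N
      using from_nat_into[OF False] by (auto simp: F_def)
    have "H = (\<Union>N. F N)"
      using F from_nat_into_surj[OF H] by (fastforce simp: F_def)
    then have AB: "A = (\<Inter>N. B (F N))"
      by (auto simp: A_def B_def)
    then have "A \<in> sets ?P"
      using B_sets F by (auto intro!: sets.countable_INT)
    moreover have "(\<lambda>N. measure ?P (B (F N))) \<longlonglongrightarrow> measure ?P A"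
      unfolding AB
    proof (rule PI.finite_Lim_measure_decseq)
      show "decseq (\<lambda>N. B (F N))"
        by (rule decseq_SucI) (auto simp: B_def F_def)
    qed (use B_sets F in auto)
    moreover have "1 - \<delta> \<le> measure ?P (B (F N))" for N
      unfolding B_def using F[of N] n \<delta> meas rng rad
      by (intro finite_class_generalization) blast+
    ultimately show ?thesis
      by (auto intro: LIMSEQ_le_const)
  qed
  then show "A \<in> sets ?P" "measure ?P A \<ge> 1 - \<delta>" by auto
qed

section \<open>The network class as an image of its parameters\<close>

text \<open>The lq norm of the vector of column sums dominates each of its entries.\<close>

lemma mat_norm_column_le:
  assumes q: "q \<ge> 1" and j: "j < b" and le: "mat_norm 1 q V a b \<le> \<gamma>"
  shows "(\<Sum>i\<le>a. \<bar>V i j\<bar>) \<le> \<gamma>"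
proof -
  define C where "C = (\<lambda>j. \<Sum>i\<le>a. \<bar>V i j\<bar>)"
  have C: "C j \<ge> 0" for j by (simp add: C_def sum_nonneg)
  have col: "col_pnorm 1 V a j = C j" for j
    using C[of j] by (simp add: col_pnorm_def C_def)
  have "C j \<le> mat_norm 1 q V a b"
  proof (cases "q = \<infinity>")
    case True
    then show ?thesis
      using j by (simp add: mat_norm_def col)
  next
    case False
    define r where "r = real_of_ereal q"
    have r: "r \<ge> 1"
      using q False by (cases q) (auto simp: r_def one_ereal_def)
    have "C j = (C j powr r) powr (1 / r)"
      using r C[of j] by (simp add: powr_powr)
    also have "\<dots> \<le> (\<Sum>j<b. C j powr r) powr (1 / r)"
      using r j by (intro powr_mono2 member_le_sum) auto
    also have "\<dots> = mat_norm 1 q V a b"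
      using False by (simp add: mat_norm_def col r_def)
    finally show ?thesis .
  qed
  then show ?thesis using le by (simp add: C_def)
qed

text \<open>Parameters are functions rather than lists in order to carry the product topology, where
  convergence is entrywise and every subset is separable.\<close>

definition admissible :: "nat \<Rightarrow> nat list \<Rightarrow> ereal \<Rightarrow> real \<Rightarrow> real \<Rightarrow> (nat \<Rightarrow> nat \<Rightarrow> nat \<Rightarrow> real) set" where
  "admissible k ds q c co = {W. (\<forall>l<k. mat_norm 1 q (W l) (ds ! l) (ds ! Suc l) = c)
     \<and> mat_norm 1 q (W k) (ds ! k) (ds ! Suc k) \<le> co}"

lemma NN_eq_image_admissible:
  assumes "k < length ds"
  shows "NN k ds 1 q c co = (\<lambda>W. pre_act W ds k) ` admissible k ds q c co"
proof (intro set_eqI iffI)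
  fix f assume "f \<in> NN k ds 1 q c co"
  then obtain Ts where Ts: "length Ts = k + 1" "f = net_eval Ts ds"
    "\<forall>i<k. mat_norm 1 q (Ts ! i) (ds ! i) (ds ! Suc i) = c"
    "mat_norm 1 q (Ts ! k) (ds ! k) (ds ! Suc k) \<le> co"
    by (auto simp: NN_def)
  have "map ((!) Ts) [0..<Suc k] = Ts"
    using Ts(1) map_nth[of Ts] by simp
  then have "f = pre_act ((!) Ts) ds k"
    using net_eval_eq_pre_act[OF assms, of "(!) Ts"] Ts(2) by auto
  moreover have "(!) Ts \<in> admissible k ds q c co"
    using Ts by (simp add: admissible_def)
  ultimately show "f \<in> (\<lambda>W. pre_act W ds k) ` admissible k ds q c co"
    by blast
next
  fix f assume "f \<in> (\<lambda>W. pre_act W ds k) ` admissible k ds q c co"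
  then obtain W where W: "W \<in> admissible k ds q c co" "f = pre_act W ds k"
    by blast
  have nth: "map W [0..<Suc k] ! i = W i" if "i \<le> k" for i
    using that by (subst nth_map_upt) auto
  have "f = net_eval (map W [0..<Suc k]) ds"
    using net_eval_eq_pre_act[OF assms] W(2) by auto
  then show "f \<in> NN k ds 1 q c co"
    unfolding NN_def using W(1) nth
    by (intro CollectI exI[of _ "map W [0..<Suc k]"]) (simp add: admissible_def del: upt_Suc)
qed

lemma tendsto_coordinate:
  fixes f :: "'m \<Rightarrow> 'i \<Rightarrow> 'b::topological_space"
  assumes "(f \<longlongrightarrow> g) F"
  shows "((\<lambda>m. f m i) \<longlongrightarrow> g i) F"
  by (rule continuous_on_tendsto_compose[OF continuous_on_product_coordinates assms]) auto

lemma tendsto_pre_act: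
  assumes "Wm \<longlonglongrightarrow> W"
  shows "(\<lambda>m. pre_act (Wm m) ds l x j) \<longlonglongrightarrow> pre_act W ds l x j"
proof -
  have entry: "(\<lambda>m. Wm m l i j) \<longlonglongrightarrow> W l i j" for l i j
    by (rule tendsto_coordinate[OF tendsto_coordinate[OF tendsto_coordinate[OF assms]]])
  show ?thesis
  proof (induction l arbitrary: j)
    case 0
    show ?case
      unfolding pre_act.simps affine_map_def
      by (intro tendsto_add tendsto_sum tendsto_mult tendsto_const entry)
  next
    case (Suc l)
    show ?case
      unfolding pre_act.simps affine_map_def relu_def
      by (intro tendsto_add tendsto_sum tendsto_mult tendsto_max tendsto_const entry Suc.IH)
  qed
qed

theorem mainTheorem10:
  fixes m1 k n :: nat and dh :: "nat list" and Y :: "real set"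
    and D :: "((nat \<Rightarrow> real) \<times> real) measure"
    and dl :: "real \<Rightarrow> real \<Rightarrow> real"
    and q :: ereal and c co \<delta> :: real
  assumes m1: "m1 \<ge> 1"
    and D: "prob_space D"
    and supp: "space D \<subseteq> {x. \<forall>i<m1. x i \<in> {-1..1}} \<times> Y"
    and d_range: "\<forall>y\<in>Y. \<forall>u. dl y u \<in> {0..1}"
    and d_lip: "\<forall>y\<in>Y. \<forall>u u'. \<bar>dl y u - dl y u'\<bar> \<le> \<bar>u - u'\<bar>"
    and q: "q \<ge> 1"
    and c: "c > 0" and co: "co > 0"
    and dh_len: "length dh = k" and dh_pos: "\<forall>w\<in>set dh. w \<ge> 1"
    and \<delta>: "0 < \<delta>" "\<delta> < 1"
    and n: "n \<ge> 1"
    and meas: "\<forall>f\<in>NN k (m1 # dh @ [1]) 1 q c co.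
                 (\<lambda>z. dl (snd z) (f (fst z) 0)) \<in> borel_measurable D"
  shows "\<exists>A \<in> sets (PiM {..<n} (\<lambda>_. D)).
           measure (PiM {..<n} (\<lambda>_. D)) A \<ge> 1 - \<delta> \<and>
           (\<forall>S\<in>A. \<forall>f\<in>NN k (m1 # dh @ [1]) 1 q c co.
              (\<integral>z. dl (snd z) (f (fst z) 0) \<partial>D)
                \<le> (1 / real n) * (\<Sum>i<n. dl (snd (S i)) (f (fst (S i)) 0))
                  + sqrt (ln (1 / \<delta>) / (2 * real n))
                  + (2 * co / sqrt (real n)) *
                    min (2 * max 1 (c ^ k) * sqrt (real k + 2 + ln (real m1 + 1)))
                        (sqrt ((real k + 1) * ln 16) * (\<Sum>i\<le>k. c ^ i)
                         + c ^ k * (sqrt (2 * ln (2 * real m1)) + sqrt ((real k + 1) * ln 16))))"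
proof -
  interpret D: prob_space D by (rule D)
  define ds where "ds = m1 # dh @ [1]"
  have ds: "k < length ds" "ds ! 0 = m1" "ds ! Suc k = 1"
    using dh_len by (auto simp: ds_def nth_append)
  have width: "ds ! l \<ge> 1" if "l \<le> Suc k" for l
  proof -
    have "ds ! l \<in> set ds" using that dh_len by (intro nth_mem) (simp add: ds_def)
    then show ?thesis using m1 dh_pos by (auto simp: ds_def)
  qed
  have inX: "\<bar>fst z i\<bar> \<le> 1" if "z \<in> space D" "i < m1" for z i
    using supp that by (fastforce simp: abs_le_iff)
  have inY: "snd z \<in> Y" if "z \<in> space D" for z
    using supp that by auto
  define Adm where "Adm = admissible k ds q c co"
  define loss where "loss = (\<lambda>W z. dl (snd z) (pre_act W ds k (fst z) 0))"
  have NN: "NN k ds 1 q c co = (\<lambda>W. pre_act W ds k) ` Adm"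
    unfolding Adm_def by (rule NN_eq_image_admissible[OF ds(1)])
  have loss_meas: "loss W \<in> borel_measurable D" if "W \<in> Adm" for W
    using meas that unfolding ds_def[symmetric] NN loss_def by blast
  have loss_rng: "loss W z \<in> {0..1}" if "z \<in> space D" for W z
    using d_range inY[OF that] by (simp add: loss_def)

  define B where "B = min (2 * max 1 (c ^ k) * sqrt (real k + 2 + ln (real m1 + 1)))
    (sqrt ((real k + 1) * ln 16) * (\<Sum>i\<le>k. c ^ i)
      + c ^ k * (sqrt (2 * ln (2 * real m1)) + sqrt ((real k + 1) * ln 16)))"
  have rad: "sign_avg n (\<lambda>\<epsilon>. MAX h\<in>F. pairing n \<epsilon> (\<lambda>i. h (S i))) \<le> sqrt n * co * B"
    if F: "finite F" "F \<noteq> {}" "F \<subseteq> loss ` Adm" and S: "\<And>i. i < n \<Longrightarrow> S i \<in> space D" for F S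
  proof -
    obtain P where PA: "P \<subseteq> Adm" "finite P" "F = loss ` P"
      using finite_subset_image[OF F(1,3)] by auto
    interpret finite_relu_class P ds k n c co "\<lambda>i. fst (S i)"
    proof unfold_locales
      show "\<bar>fst (S i) m\<bar> \<le> 1" if "i < n" "m < ds ! 0" for i m
        using inX[OF S[OF that(1)]] that(2) ds by simp
      show "(\<Sum>i\<le>ds ! l. \<bar>W l i j\<bar>) \<le> c" if "W \<in> P" "l < k" "j < ds ! Suc l" for W l j
        using PA(1) that by (intro mat_norm_column_le[OF q that(3)]) (auto simp: Adm_def admissible_def)
      show "(\<Sum>i\<le>ds ! k. \<bar>W k i j\<bar>) \<le> co" if "W \<in> P" "j < ds ! Suc k" for W j
        using PA(1) that by (intro mat_norm_column_le[OF q that(2)]) (auto simp: Adm_def admissible_def)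
    qed (use PA F n c co width in auto)
    have "sign_avg n (\<lambda>\<epsilon>. MAX h\<in>F. pairing n \<epsilon> (\<lambda>i. h (S i)))
        = sign_avg n (\<lambda>\<epsilon>. MAX W\<in>P. pairing n \<epsilon> (\<lambda>i. dl (snd (S i)) (pre_act W ds k (fst (S i)) 0)))"
      by (simp add: PA(3) image_image loss_def)
    also have "\<dots> \<le> sign_avg n (\<lambda>\<epsilon>. MAX W\<in>P. pairing n \<epsilon> (\<lambda>i. pre_act W ds k (fst (S i)) 0))"
      using PA F d_lip inY[OF S] by (intro sign_avg_Max_lipschitz_le[where \<phi> = "\<lambda>i. dl (snd (S i))"]) auto
    also have "\<dots> \<le> sqrt n * co * B"
      using rademacher_bound unfolding B_def ds(2) .
    finally show ?thesis .
  qed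

  \<comment> \<open>Separability is applied to the admissible set itself, so the approximating
    networks satisfy the norm equalities exactly and the class bound applies to them.\<close>
  obtain Q where Q: "countable Q" "Q \<subseteq> Adm" "Adm \<subseteq> closure Q"
    using separable[of Adm] by blast
  \<comment> \<open>Only countably many conditions, hence a measurable event; the remaining networks
    are reached for each sample in \<open>A\<close> by passing to the limit in a non-strict
    inequality.\<close>
  define A where "A = {S \<in> space (PiM {..<n} (\<lambda>_. D)). \<forall>h\<in>loss ` Q.
    D.expectation h \<le> (1 / n) * (\<Sum>i<n. h (S i)) + sqrt (ln (1 / \<delta>) / (2 * real n)) + 2 * (sqrt n * co * B) / n}"
  have radQ: "sign_avg n (\<lambda>\<epsilon>. MAX h\<in>F. pairing n \<epsilon> (\<lambda>i. h (S i))) \<le> sqrt n * co * B"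
    if "finite F" "F \<noteq> {}" "F \<subseteq> loss ` Q" "\<And>i. i < n \<Longrightarrow> S i \<in> space D" for F S
    using that Q(2) by (intro rad) auto
  have A: "A \<in> sets (PiM {..<n} (\<lambda>_. D))" "measure (PiM {..<n} (\<lambda>_. D)) A \<ge> 1 - \<delta>"
    unfolding A_def
    by (rule D.countable_class_generalization;
        use Q loss_meas loss_rng n \<delta> in \<open>auto intro!: radQ\<close>)+

  have scale: "2 * (sqrt n * co * B) / n = (2 * co / sqrt n) * B"
    using n by (simp add: field_simps)

  have "(\<integral>z. loss W z \<partial>D) \<le> (1 / n) * (\<Sum>i<n. loss W (S i)) + sqrt (ln (1 / \<delta>) / (2 * real n))
      + (2 * co / sqrt n) * B" if S: "S \<in> A" and W: "W \<in> Adm" for S W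
  proof -
    have "W \<in> closure Q" using Q(3) W by blast
    then obtain Wm where Wm: "\<And>m. Wm m \<in> Q" "Wm \<longlonglongrightarrow> W"
      unfolding closure_sequential by blast
    have lim: "(\<lambda>m. loss (Wm m) z) \<longlonglongrightarrow> loss W z" if z: "z \<in> space D" for z
    proof (rule Lim_null_comparison[THEN LIM_zero_cancel])
      show "\<forall>\<^sub>F m in sequentially. norm (loss (Wm m) z - loss W z)
          \<le> \<bar>pre_act (Wm m) ds k (fst z) 0 - pre_act W ds k (fst z) 0\<bar>"
        using d_lip inY[OF z] by (simp add: loss_def)
      show "(\<lambda>m. \<bar>pre_act (Wm m) ds k (fst z) 0 - pre_act W ds k (fst z) 0\<bar>) \<longlonglongrightarrow> 0"
        by (intro tendsto_rabs_zero LIM_zero tendsto_pre_act Wm(2))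
    qed
    have Sspace: "S i \<in> space D" if "i < n" for i
      using S that by (auto simp: A_def space_PiM)
    show ?thesis
    proof (rule LIMSEQ_le)
      \<comment> \<open>The losses lie between 0 and 1, so pointwise convergence suffices, with the
        constant 1 as dominating function.\<close>
      show "(\<lambda>m. \<integral>z. loss (Wm m) z \<partial>D) \<longlonglongrightarrow> (\<integral>z. loss W z \<partial>D)"
        using W Wm(1) Q(2) loss_meas loss_rng lim
        by (intro integral_dominated_convergence[where w = "\<lambda>_. 1"]) (auto intro!: AE_I2)
      show "(\<lambda>m. (1 / n) * (\<Sum>i<n. loss (Wm m) (S i)) + sqrt (ln (1 / \<delta>) / (2 * real n)) + (2 * co / sqrt n) * B)
          \<longlonglongrightarrow> (1 / n) * (\<Sum>i<n. loss W (S i)) + sqrt (ln (1 / \<delta>) / (2 * real n)) + (2 * co / sqrt n) * B"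
        using Sspace by (intro tendsto_intros lim) auto
      show "\<exists>N. \<forall>m\<ge>N. (\<integral>z. loss (Wm m) z \<partial>D) \<le> (1 / n) * (\<Sum>i<n. loss (Wm m) (S i))
          + sqrt (ln (1 / \<delta>) / (2 * real n)) + (2 * co / sqrt n) * B"
        using S Wm(1) unfolding A_def scale by blast
    qed
  qed
  then show ?thesis
    using A unfolding ds_def[symmetric] NN B_def[symmetric] loss_def
    by (intro bexI[of _ A]) auto
qed

end
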